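(* Let $\mathbf{R}$ be a strongly discrete coherent commutative ring with unit, let $n,m\ge1$, let $\mathbf{R}[\underline{X}]=\mathbf{R}[X_1,\dots,X_n]$, and let $\mathbf{H}_n^m$ be a free $\mathbf{R}[\underline{X}]$-module with basis $(e_1,\dots,e_m)$. Let $U$ be a finitely generated submodule of $\mathbf{H}_n^m$, and let $>$ be a monomial order on $\mathbf{H}_n^m$ such that $\operatorname{MLT}(U)$ (with respect to $>$) is finitely generated. Then $M=\mathbf{H}_n^m/U$ admits an $\mathbf{R}[\underline{X}]$-resolution (exact sequence) \[0\rightarrow F_q/V\rightarrow F_{q-1}\rightarrow\cdots\rightarrow F_1\rightarrow F_0\rightarrow M\rightarrow0\] such that $1\le q\le n+1$, $F_0,\dots,F_q$ are finitely generated free $\mathbf{R}[\underline{X}]$-modules, and $V$ is a submodule of $F_q$ generated by finitely many iterated syzygies whose leading terms with respect to Schreyer's induced monomial order do not depend on the indeterminates $X_n,\dots,X_1$.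
   Context: **Rings.** A ring $\mathbf{R}$ is strongly discrete if there is a membership test for finitely generated ideals: given $a,b_1,\dots,b_k$ one can decide whether $a\in\langle b_1,\dots,b_k\rangle$ and, if so, compute $c_i$ with $a=\sum b_ic_i$. For elements $v_1,\dots,v_k$ of an $A$-module, $\operatorname{Syz}(v_1,\dots,v_k)=\{(b_1,\dots,b_k)\in A^k : \sum b_iv_i=0\}$. $\mathbf{R}$ is coherent if the syzygy module of every finite family of elements of $\mathbf{R}$ is finitely generated (constructively: with algorithms computing generators and expressing syzygies in terms of them). $\langle\cdots\rangle$ denotes the submodule (or ideal) generated. **Monomials.** Let $F$ be a free $\mathbf{R}[\underline{X}]$-module with finite basis $(e_i)$. A monomial of $F$ is a vector $\underline{X}^\alpha e_i$. A monomial order on $F$ is a total order $>$ on its monomials such that $\underline{X}^\alpha M>M$ for all monomials $M$ and $\underline{X}^\alpha\ne1$, and $M>N\Rightarrow \underline{X}^\alpha M>\underline{X}^\alpha N$. A nonzero $u\in F$ is uniquely $c_tM_t+\dots+c_1M_1$ with $c_i\in\mathbf{R}\setminus\{0\}$ and monomials $M_t>\dots>M_1$; $\operatorname{LM}(u)=M_t$, $\operatorname{LT}(u)=c_tM_t$; $\operatorname{LT}(0)=0$. For a submodule $W\subseteq F$, $\operatorname{MLT}(W)=\langle \operatorname{LT}(u):u\in W\rangle$. A list $g_1,\dots,g_k$ of nonzero vectors is a Gröbner basis for $W=\langle g_1,\dots,g_k\rangle$ if $\operatorname{MLT}(W)=\langle \operatorname{LT}(g_1),\dots,\operatorname{LT}(g_k)\rangle$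 (the empty list is a Gröbner basis for $0$). **Schreyer's monomial order.** Given a monomial order $>$ on $F$ and a list $G=g_1,\dots,g_k$ in $F\setminus\{0\}$, Schreyer's monomial order $>_G$ induced by $>$ and $G$ is the order on monomials of $\mathbf{R}[\underline{X}]^k$ (canonical basis $(\epsilon_1,\dots,\epsilon_k)$) with $\underline{X}^\alpha\epsilon_i>_G\underline{X}^\beta\epsilon_j$ iff either $\operatorname{LM}(\underline{X}^\alpha g_i)>\operatorname{LM}(\underline{X}^\beta g_j)$, or both $\operatorname{LM}(\underline{X}^\alpha g_i)=\operatorname{LM}(\underline{X}^\beta g_j)$ and $i<j$. **Iterated syzygies.** The wording about $V$ means the following. There are lists $G_0,G_1,\dots,G_q$ such that: $F_0=\mathbf{H}_n^m$ with order $>_0\,=\,>$; $G_0$ is a Gröbner basis for $U$ with respect to $>_0$; for $1\le k\le q$, $F_k$ is the free module $\mathbf{R}[\underline{X}]^{p_{k-1}}$ where $p_{k-1}$ is the length of $G_{k-1}$, $>_k$ is Schreyer's monomial order on $F_k$ induced by $>_{k-1}$ and $G_{k-1}$, and $G_k$ is a Gröbner basis, with respect to $>_k$, for $\operatorname{Syz}(G_{k-1})\subseteq F_k$. The map $F_k\to F_{k-1}$ sends the $i$th canonical basis vector to the $i$th item of $G_{k-1}$, for $1\le k\le q$; the last map $F_q/V\to F_{q-1}$ is the one induced by $F_q\to F_{q-1}$, and $F_0\to M$ is the canonical projection. Finally $V=\langle G_q\rangle\subseteq F_q$, and for each $g\in G_q$ the leading monomial of $g$ with respect to $>_q$ is a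 basis vector of $F_q$, i.e. involves none of $X_1,\dots,X_n$. (Rank-zero free modules and empty lists are allowed.) *)

theory Defs
  imports "HOL-Library.Poly_Mapping" "HOL-Library.Cardinality" "HOL-Algebra.Module" "HOL-Algebra.AbelCoset"
begin

text \<open>
  The sort \<open>{comm_ring, comm_monoid_mult}\<close> is that of commutative rings with unit in which
  \<open>1 = 0\<close> is allowed (\<^class>\<open>comm_ring_1\<close> adds \<open>0 \<noteq> 1\<close>).  Over such a ring the library provides
  no constant \<open>1\<close> for polynomials; the unit polynomial is \<open>Poly_Mapping.single 0 1\<close>.
\<close>


section \<open>Free modules, generated submodules, syzygies\<close>

text \<open>
  For a commutative ring \<open>'r\<close> (used both for the ground ring and for the polynomial ring), an
  element of \<open>'r\<^sup>p\<close> is a finitely supported \<open>nat \<Rightarrow>\<^sub>0 'r\<close> vanishing outside \<open>{..<p}\<close>;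
  coordinates and lists are thus indexed from 0.
\<close>

definition scale :: "'r::comm_ring \<Rightarrow> (nat \<Rightarrow>\<^sub>0 'r) \<Rightarrow> (nat \<Rightarrow>\<^sub>0 'r)" (infixr \<open>*s\<close> 75)
  where "a *s v = Poly_Mapping.map ((*) a) v"

text \<open>The record \<^typ>\<open>('r, 'b) module\<close> extends that of rings; its fields \<open>mult\<close> and \<open>one\<close> play no
  role in modules.\<close>

definition free_module :: "nat \<Rightarrow> ('r::comm_ring, nat \<Rightarrow>\<^sub>0 'r) module"
  where "free_module p =
    \<lparr>carrier = {v. Poly_Mapping.keys v \<subseteq> {..<p}}, monoid.mult = undefined, one = undefined,
     zero = 0, add = (+), smult = (*s)\<rparr>"

definition generated :: "(nat \<Rightarrow>\<^sub>0 'r::comm_ring) set \<Rightarrow> (nat \<Rightarrow>\<^sub>0 'r) set"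
  where "generated S = {(\<Sum>v\<in>T. c v *s v) | c T. finite T \<and> T \<subseteq> S}"

definition finitely_generated :: "(nat \<Rightarrow>\<^sub>0 'r::comm_ring) set \<Rightarrow> bool"
  where "finitely_generated W \<longleftrightarrow> (\<exists>S. finite S \<and> W = generated S)"

text \<open>The first argument is the scalar multiplication of the module in which the \<open>vs\<close> live.\<close>

definition combination ::
    "('r::comm_ring \<Rightarrow> 'b \<Rightarrow> 'b::comm_monoid_add) \<Rightarrow> 'b list \<Rightarrow> (nat \<Rightarrow>\<^sub>0 'r) \<Rightarrow> 'b"
  where "combination sm vs b = (\<Sum>i<length vs. sm (Poly_Mapping.lookup b i) (vs ! i))"

definition Syz ::
    "('r::comm_ring \<Rightarrow> 'b \<Rightarrow> 'b::comm_monoid_add) \<Rightarrow> 'b list \<Rightarrow> (nat \<Rightarrow>\<^sub>0 'r) set"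
  where "Syz sm vs = {b \<in> carrier (free_module (length vs)). combination sm vs b = 0}"


section \<open>Strongly discrete and coherent rings\<close>

text \<open>
  The function \<open>test\<close> decides membership of \<open>a\<close> in the ideal generated by \<open>bs\<close> and returns the
  coefficients of a representation.  In classical logic such a function always exists.
\<close>

definition strongly_discrete :: "'r::comm_ring itself \<Rightarrow> bool"
  where "strongly_discrete _ \<longleftrightarrow>
    (\<exists>test :: 'r \<Rightarrow> 'r list \<Rightarrow> 'r list option. \<forall>a bs.
       case test a bs of
         Some cs \<Rightarrow> length cs = length bs \<and> a = (\<Sum>i<length bs. bs ! i * cs ! i)
       | None \<Rightarrow> \<not> (\<exists>cs. length cs = length bs \<and> a = (\<Sum>i<length bs. bs ! i * cs ! i)))"

definition coherent_ring :: "'r::comm_ring itself \<Rightarrow> bool"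
  where "coherent_ring _ \<longleftrightarrow> (\<forall>vs :: 'r list. finitely_generated (Syz (*) vs))"


section \<open>Monomials and monomial orders\<close>

text \<open>
  The indeterminates are indexed by a finite type \<open>'x\<close>, so their number is \<open>CARD('x)\<close>.  The
  monomial \<open>X\<^sup>\<alpha> e\<^sub>i\<close> is encoded by the pair \<open>(\<alpha>, i)\<close>.
\<close>

type_synonym ('x, 'a) mpoly = "('x \<Rightarrow>\<^sub>0 nat) \<Rightarrow>\<^sub>0 'a"
type_synonym ('x, 'a) mvec = "nat \<Rightarrow>\<^sub>0 ('x, 'a) mpoly"
type_synonym 'x monom = "('x \<Rightarrow>\<^sub>0 nat) \<times> nat"
type_synonym 'x monom_rel = "'x monom \<Rightarrow> 'x monom \<Rightarrow> bool"

definition monoms :: "nat \<Rightarrow> 'x monom set"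
  where "monoms p = {(\<alpha>, i). i < p}"

definition shift :: "('x \<Rightarrow>\<^sub>0 nat) \<Rightarrow> 'x monom \<Rightarrow> 'x monom"
  where "shift \<alpha> M = (\<alpha> + fst M, snd M)"

definition monomial_order :: "nat \<Rightarrow> 'x monom_rel \<Rightarrow> bool"
  where "monomial_order p gt \<longleftrightarrow>
    irreflp_on (monoms p) gt \<and> transp_on (monoms p) gt \<and> totalp_on (monoms p) gt \<and>
    (\<forall>M\<in>monoms p. \<forall>\<alpha>. \<alpha> \<noteq> 0 \<longrightarrow> gt (shift \<alpha> M) M) \<and>
    (\<forall>M\<in>monoms p. \<forall>N\<in>monoms p. \<forall>\<alpha>. gt M N \<longrightarrow> gt (shift \<alpha> M) (shift \<alpha> N))"

definition coefficient :: "('x, 'a::zero) mvec \<Rightarrow> 'x monom \<Rightarrow> 'a"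
  where "coefficient u M = Poly_Mapping.lookup (Poly_Mapping.lookup u (snd M)) (fst M)"

definition LM :: "'x monom_rel \<Rightarrow> ('x, 'a::zero) mvec \<Rightarrow> 'x monom"
  where "LM gt u = (THE M. coefficient u M \<noteq> 0 \<and>
    (\<forall>N. coefficient u N \<noteq> 0 \<and> N \<noteq> M \<longrightarrow> gt M N))"

definition LT :: "'x monom_rel \<Rightarrow> ('x, 'a::zero) mvec \<Rightarrow> ('x, 'a) mvec"
  where "LT gt u = (if u = 0 then 0 else
    Poly_Mapping.single (snd (LM gt u))
      (Poly_Mapping.single (fst (LM gt u)) (coefficient u (LM gt u))))"

definition MLT :: "'x monom_rel \<Rightarrow> ('x, 'a::comm_ring) mvec set \<Rightarrow> ('x, 'a) mvec set"
  where "MLT gt W = generated (LT gt ` W)"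

definition groebner_basis ::
    "nat \<Rightarrow> 'x monom_rel \<Rightarrow> ('x, 'a::comm_ring) mvec list \<Rightarrow> ('x, 'a) mvec set \<Rightarrow> bool"
  where "groebner_basis p gt G W \<longleftrightarrow>
    set G \<subseteq> carrier (free_module p) - {0} \<and> W = generated (set G) \<and>
    MLT gt W = generated (LT gt ` set G)"


section \<open>Iterated syzygies\<close>

definition schreyer_order ::
    "'x monom_rel \<Rightarrow> ('x, 'a::{comm_ring, comm_monoid_mult}) mvec list \<Rightarrow> 'x monom_rel"
  where "schreyer_order gt G = (\<lambda>(\<alpha>, i) (\<beta>, j).
    let M = LM gt (Poly_Mapping.single \<alpha> 1 *s G ! i);
        N = LM gt (Poly_Mapping.single \<beta> 1 *s G ! j)
    in i < length G \<and> j < length G \<and> (gt M N \<or> M = N \<and> i < j))"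

primrec iterated_order ::
    "'x monom_rel \<Rightarrow> (nat \<Rightarrow> ('x, 'a::{comm_ring, comm_monoid_mult}) mvec list) \<Rightarrow>
     nat \<Rightarrow> 'x monom_rel"
  where
    "iterated_order gt G 0 = gt"
  | "iterated_order gt G (Suc k) = schreyer_order (iterated_order gt G k) (G k)"

primrec iterated_rank :: "nat \<Rightarrow> (nat \<Rightarrow> 'b list) \<Rightarrow> nat \<Rightarrow> nat"
  where
    "iterated_rank m G 0 = m"
  | "iterated_rank m G (Suc k) = length (G k)"

definition iterated_syzygies ::
    "nat \<Rightarrow> 'x monom_rel \<Rightarrow> ('x, 'a::{comm_ring, comm_monoid_mult}) mvec set \<Rightarrow> nat \<Rightarrow>
     (nat \<Rightarrow> ('x, 'a) mvec list) \<Rightarrow> bool"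
  where "iterated_syzygies m gt U q G \<longleftrightarrow>
    groebner_basis m gt (G 0) U \<and>
    (\<forall>k\<in>{1..q}. groebner_basis (iterated_rank m G k) (iterated_order gt G k) (G k)
                  (Syz (*s) (G (k - 1))))"


section \<open>Quotient modules and resolutions\<close>

definition quotient_module :: "('r, 'b) module \<Rightarrow> 'b set \<Rightarrow> ('r, 'b set) module"
  where "quotient_module M W =
    \<lparr>carrier = a_rcosets\<^bsub>M\<^esub> W, monoid.mult = undefined, one = undefined,
     zero = W, add = set_add M, smult = (\<lambda>a C. \<Union>x\<in>C. W +>\<^bsub>M\<^esub> (a \<odot>\<^bsub>M\<^esub> x))\<rparr>"

text \<open>All elements of the type \<open>'r\<close> are scalars.\<close>

definition linear_maps :: "('r, 'b) module \<Rightarrow> ('r, 'c) module \<Rightarrow> ('b \<Rightarrow> 'c) set"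
  where "linear_maps M N = {h \<in> hom (add_monoid M) (add_monoid N).
    \<forall>a. \<forall>x\<in>carrier M. h (a \<odot>\<^bsub>M\<^esub> x) = a \<odot>\<^bsub>N\<^esub> h x}"

text \<open>
  Exactness of the sequence of \<open>'r\<close>-modules \<open>0 \<rightarrow> Q \<rightarrow> F\<^sub>q\<^sub>-\<^sub>1 \<rightarrow> \<dots> \<rightarrow> F\<^sub>1 \<rightarrow> F\<^sub>0 \<rightarrow> M \<rightarrow> 0\<close> with maps
  \<open>\<delta> : Q \<rightarrow> F\<^sub>q\<^sub>-\<^sub>1\<close>, \<open>d k : F\<^sub>k \<rightarrow> F\<^sub>k\<^sub>-\<^sub>1\<close> for \<open>0 < k < q\<close> and \<open>\<pi> : F\<^sub>0 \<rightarrow> M\<close>, where \<open>q \<ge> 1\<close>.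
\<close>

definition exact_resolution ::
    "nat \<Rightarrow> ('r, 'c) module \<Rightarrow> ('c \<Rightarrow> 'b) \<Rightarrow> (nat \<Rightarrow> ('r, 'b) module) \<Rightarrow> (nat \<Rightarrow> 'b \<Rightarrow> 'b) \<Rightarrow>
     ('b \<Rightarrow> 'd) \<Rightarrow> ('r, 'd) module \<Rightarrow> bool"
  where "exact_resolution q Q \<delta> F d \<pi> M \<longleftrightarrow>
    \<delta> \<in> linear_maps Q (F (q - 1)) \<and>
    (\<forall>k\<in>{1..<q}. d k \<in> linear_maps (F k) (F (k - 1))) \<and>
    \<pi> \<in> linear_maps (F 0) M \<and>
    a_kernel Q (F (q - 1)) \<delta> = {\<zero>\<^bsub>Q\<^esub>} \<and>
    (\<forall>k<q. (if k + 1 = q then \<delta> ` carrier Q else d (k + 1) ` carrier (F (k + 1))) =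
           (if k = 0 then a_kernel (F 0) M \<pi> else a_kernel (F k) (F (k - 1)) (d k))) \<and>
    \<pi> ` carrier (F 0) = carrier M"

text \<open>The map \<open>M/W \<rightarrow> N\<close> induced by a map \<open>h : M \<rightarrow> N\<close> that is constant on the cosets of \<open>W\<close>.\<close>

definition induced_map :: "('b \<Rightarrow> 'c) \<Rightarrow> 'b set \<Rightarrow> 'c"
  where "induced_map h C = the_elem (h ` C)"

end

theory Submission
  imports Defs "HOL-Library.Ramsey"
begin

text \<open>
  Let \<open>G = g\<^sub>0, \<dots>, g\<^sub>r\<close> be a Groebner basis.  The map that sends the basis vector \<open>\<epsilon>\<^sub>i\<close> to \<open>g\<^sub>i\<close>
  carries \<open>b X\<^sup>\<alpha> \<epsilon>\<^sub>i\<close> to a vector all of whose terms lie at or below \<open>X\<^sup>\<alpha> LM(g\<^sub>i)\<close>, the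
  \<^emph>\<open>image monomial\<close> of \<open>X\<^sup>\<alpha> \<epsilon>\<^sub>i\<close>; Schreyer's order compares image monomials first and
  prefers small indices among equals.  Consider a syzygy \<open>u\<close> with leading monomial \<open>X\<^sup>\<alpha> \<epsilon>\<^sub>i\<close>, and
  let \<open>M\<close> be the image monomial of the latter.  Only those terms of \<open>u\<close> contribute to the
  coefficient at \<open>M\<close> whose image monomial is \<open>M\<close>; they have indices \<open>\<ge> i\<close>, and since the
  contributions add up to \<open>0\<close> the coefficients of these terms form a relation between the leading
  coefficients of the \<open>g\<^sub>j\<close> with \<open>j \<ge> i\<close> and \<open>LM(g\<^sub>j)\<close> dividing \<open>M\<close>
  (\<open>leading_term_of_syzygy\<close>).

  Conversely, let \<open>E\<close> be a set of indices such that the \<open>LM(g\<^sub>j)\<close>, \<open>j \<in> E\<close>, involve the same basis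
  vector, and let \<open>L\<close> be their least common multiple.  A relation \<open>\<Sum>\<^sub>j b\<^sub>j lc(g\<^sub>j) = 0\<close> over \<open>E\<close>
  makes \<open>\<Sum>\<^sub>j b\<^sub>j (L / LM(g\<^sub>j)) g\<^sub>j\<close> lose its term at \<open>L\<close>.  What is left can be divided by \<open>G\<close> using
  only terms with image monomial below \<open>L\<close> (\<open>division\<close>), and subtracting the quotients yields a
  syzygy with leading term \<open>b\<^sub>i (L / LM(g\<^sub>i)) \<epsilon>\<^sub>i\<close> for \<open>i = Min E\<close>, provided that \<open>b\<^sub>i \<noteq> 0\<close>
  (\<open>ex_syzygy_with_leading_term\<close>).  There are finitely many sets \<open>E\<close>, and by coherence the
  relations over each of them are finitely generated; so finitely many such syzygies have leading
  terms that generate all leading terms of syzygies (\<open>finite_leading_terms_of_syzygies\<close>), and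
  they form a Groebner basis of the syzygy module, in any order.

  The freedom to order them eliminates the indeterminates one at a time.  If the exponents of \<open>x\<close>
  in the leading monomials descend along \<open>G\<close>, then the exponent of \<open>x\<close> in \<open>L\<close> is attained by
  \<open>LM(g\<^sub>i)\<close> with \<open>i = Min E\<close>, and \<open>L / LM(g\<^sub>i)\<close> is free of \<open>x\<close> (\<open>lookup_leading_candidate\<close>).  An
  indeterminate that occurs in no leading monomial has constant exponents \<open>0\<close>, which descend in a
  trivial way; once eliminated it stays eliminated.  Sorting the \<open>k\<close>-th basis with respect to the
  \<open>k\<close>-th indeterminate therefore leaves, after as many steps as there are indeterminates, leading
  monomials that are basis vectors (\<open>ex_iterated_syzygies\<close>).

  Exactness is built into the construction: the kernel of each map is the syzygy module of the
  list that defines it, which the next list generates, and dividing by the last syzygy module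
  makes the last map injective (\<open>exact_resolution_of_iterated_syzygies\<close>).
\<close>


section \<open>Linear algebra in free modules\<close>

lemma lookup_scale [simp]: "Poly_Mapping.lookup (a *s v) i = a * Poly_Mapping.lookup v i"
  by (simp add: scale_def map.rep_eq when_def)

lemma scale_zero_left [simp]: "0 *s v = 0"
  and scale_zero_right [simp]: "a *s 0 = 0"
  and scale_add_left: "(a + b) *s v = a *s v + b *s v"
  and scale_diff_left: "(a - b) *s v = a *s v - b *s v"
  and scale_diff_right: "a *s (v - w) = a *s v - a *s w"
  and scale_scale: "a *s b *s v = (a * b) *s v"
  by (rule poly_mapping_eqI; simp add: lookup_add lookup_minus algebra_simps)+

lemma scale_sum_right: "a *s sum f T = (\<Sum>t\<in>T. a *s f t)"
  by (rule poly_mapping_eqI) (simp add: lookup_sum sum_distrib_left)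

text \<open>
  Products of polynomials are only ever needed when one factor is a monomial, where they shift
  exponents and no convolution sum remains.
\<close>

lemma lookup_monomial_times:
  fixes f :: "('x, 'a::comm_ring) mpoly"
  shows "Poly_Mapping.lookup (Poly_Mapping.single \<alpha> c * f) \<kappa> =
    (if \<exists>\<beta>. \<kappa> = \<alpha> + \<beta> then c * Poly_Mapping.lookup f (\<kappa> - \<alpha>) else 0)"
proof -
  have "(\<Sum>q. Poly_Mapping.lookup f q when \<kappa> = \<alpha> + q) =
      (if \<exists>\<beta>. \<kappa> = \<alpha> + \<beta> then Poly_Mapping.lookup f (\<kappa> - \<alpha>) else 0)"
    by auto
  then show ?thesis
    by (simp add: lookup_mult lookup_single when_mult)
qed

lemma unit_polynomial_times [simp]:
  fixes f :: "('x, 'a::{comm_ring, comm_monoid_mult}) mpoly"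
  shows "Poly_Mapping.single 0 1 * f = f"
  by (rule poly_mapping_eqI) (simp add: lookup_monomial_times)

lemma scale_unit_polynomial [simp]:
  fixes v :: "('x, 'a::{comm_ring, comm_monoid_mult}) mvec"
  shows "Poly_Mapping.single 0 1 *s v = v"
  by (rule poly_mapping_eqI) simp

text \<open>
  Closure under differences is part of the definition because a scalar ring without unit has no
  scalar \<open>- 1\<close> that would produce negatives.
\<close>

definition is_submodule :: "(nat \<Rightarrow>\<^sub>0 'r::comm_ring) set \<Rightarrow> bool"
  where "is_submodule W \<longleftrightarrow>
    0 \<in> W \<and> (\<forall>v\<in>W. \<forall>w\<in>W. v - w \<in> W) \<and> (\<forall>a. \<forall>v\<in>W. a *s v \<in> W)"

lemma
  assumes "is_submodule W"
  shows submodule_zero: "0 \<in> W"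
    and submodule_diff: "v \<in> W \<Longrightarrow> w \<in> W \<Longrightarrow> v - w \<in> W"
    and submodule_scale: "v \<in> W \<Longrightarrow> a *s v \<in> W"
  using assms by (auto simp: is_submodule_def)

lemma submodule_uminus: "is_submodule W \<Longrightarrow> v \<in> W \<Longrightarrow> - v \<in> W"
  using submodule_diff[of W 0 v] submodule_zero[of W] by simp

lemma submodule_add: "is_submodule W \<Longrightarrow> v \<in> W \<Longrightarrow> w \<in> W \<Longrightarrow> v + w \<in> W"
  using submodule_diff[of W v "- w"] submodule_uminus[of W w] by simp

lemma submodule_sum: "is_submodule W \<Longrightarrow> (\<And>t. t \<in> T \<Longrightarrow> f t \<in> W) \<Longrightarrow> sum f T \<in> W"
  by (induction T rule: infinite_finite_induct) (auto simp: submodule_zero submodule_add)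

text \<open>
  Without a unit in the scalar ring, \<open>S\<close> need not be contained in the submodule that it generates;
  hence the premise on the multiples of elements of \<open>S\<close>.
\<close>

lemma generated_least:
  assumes "is_submodule W" and "\<And>c v. v \<in> S \<Longrightarrow> c *s v \<in> W"
  shows "generated S \<subseteq> W"
  using assms by (auto simp: generated_def intro!: submodule_sum)

lemma scale_in_generated: "v \<in> S \<Longrightarrow> c *s v \<in> generated S"
  unfolding generated_def by (auto intro!: exI[of _ "\<lambda>_. c"] exI[of _ "{v}"])

lemma generated_superset:
  fixes S :: "('x, 'a::{comm_ring, comm_monoid_mult}) mvec set"
  shows "S \<subseteq> generated S"
  using scale_in_generated[of _ S "Poly_Mapping.single 0 1"] by auto

lemma submodule_generated: "is_submodule (generated S)"
  unfolding is_submodule_def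
proof (intro conjI ballI allI)
  show "0 \<in> generated S"
    by (auto simp: generated_def intro!: exI[of _ "{}"])
next
  fix v w assume "v \<in> generated S" "w \<in> generated S"
  then obtain c T d T' where *: "finite T" "T \<subseteq> S" "finite T'" "T' \<subseteq> S"
    and vw: "v = (\<Sum>t\<in>T. c t *s t)" "w = (\<Sum>t\<in>T'. d t *s t)"
    by (auto simp: generated_def)
  have "v = (\<Sum>t\<in>T \<union> T'. (if t \<in> T then c t else 0) *s t)"
    unfolding vw using * by (intro sum.mono_neutral_cong_left) auto
  moreover have "w = (\<Sum>t\<in>T \<union> T'. (if t \<in> T' then d t else 0) *s t)"
    unfolding vw using * by (intro sum.mono_neutral_cong_left) auto
  ultimately have "v - w =
      (\<Sum>t\<in>T \<union> T'. ((if t \<in> T then c t else 0) - (if t \<in> T' then d t else 0)) *s t)"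
    by (simp add: sum_subtractf scale_diff_left)
  with * show "v - w \<in> generated S"
    unfolding generated_def
    by (intro CollectI exI[of _ "T \<union> T'"]
        exI[of _ "\<lambda>t. (if t \<in> T then c t else 0) - (if t \<in> T' then d t else 0)"]) auto
next
  fix a v assume "v \<in> generated S"
  then obtain c T where *: "finite T" "T \<subseteq> S" and v: "v = (\<Sum>t\<in>T. c t *s t)"
    by (auto simp: generated_def)
  have "a *s v = (\<Sum>t\<in>T. (a * c t) *s t)"
    by (simp add: v scale_sum_right scale_scale)
  with * show "a *s v \<in> generated S"
    unfolding generated_def by (intro CollectI exI[of _ T] exI[of _ "\<lambda>t. a * c t"]) auto
qed

lemma generated_mono: "S \<subseteq> S' \<Longrightarrow> generated S \<subseteq> generated S'"
  unfolding generated_def by blast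

lemma carrier_free_module:
  "v \<in> carrier (free_module p) \<longleftrightarrow> (\<forall>i. Poly_Mapping.lookup v i \<noteq> 0 \<longrightarrow> i < p)"
  by (auto simp: free_module_def in_keys_iff)

lemma submodule_free_module: "is_submodule (carrier (free_module p))"
  by (auto simp: is_submodule_def carrier_free_module lookup_minus)
    (metis diff_self, metis mult_zero_right)

lemma combination_zero [simp]: "combination (*s) vs 0 = 0"
  and combination_add:
    "combination (*s) vs (b + c) = combination (*s) vs b + combination (*s) vs c"
  and combination_diff:
    "combination (*s) vs (b - c) = combination (*s) vs b - combination (*s) vs c"
  and combination_scale: "combination (*s) vs (a *s b) = a *s combination (*s) vs b"
  by (simp_all add: combination_def lookup_add lookup_minus scale_add_left scale_diff_left
      sum.distrib sum_subtractf scale_sum_right scale_scale)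

lemma combination_sum:
  "combination (*s) vs (sum f T) = (\<Sum>t\<in>T. combination (*s) vs (f t))"
  by (induction T rule: infinite_finite_induct) (simp_all add: combination_add)

lemma combination_single:
  assumes "i < length vs"
  shows "combination (*s) vs (Poly_Mapping.single i c) = c *s vs ! i"
proof -
  have "combination (*s) vs (Poly_Mapping.single i c) =
      (\<Sum>j<length vs. if j = i then c *s vs ! j else 0)"
    unfolding combination_def by (rule sum.cong) (auto simp: lookup_single when_def)
  then show ?thesis using assms by simp
qed

lemma submodule_combination: "is_submodule W \<Longrightarrow> set vs \<subseteq> W \<Longrightarrow> combination (*s) vs b \<in> W"
  unfolding combination_def by (auto intro!: submodule_sum submodule_scale)

lemma generated_list:
  "generated (set vs) = combination (*s) vs ` carrier (free_module (length vs))"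
proof
  have "is_submodule (combination (*s) vs ` carrier (free_module (length vs)))"
    unfolding is_submodule_def
    using submodule_free_module[of "length vs"]
    by (auto simp: is_submodule_def simp flip: combination_diff combination_scale
        intro: rev_image_eqI[where x=0])
  moreover have "c *s v \<in> combination (*s) vs ` carrier (free_module (length vs))"
    if v: "v \<in> set vs" for c v
  proof -
    obtain i where "i < length vs" "v = vs ! i"
      using v by (auto simp: in_set_conv_nth)
    then show ?thesis
      by (intro image_eqI[where x="Poly_Mapping.single i c"])
        (auto simp: combination_single carrier_free_module lookup_single when_def)
  qed
  ultimately show "generated (set vs) \<subseteq> combination (*s) vs ` carrier (free_module (length vs))"
    by (rule generated_least)
  show "combination (*s) vs ` carrier (free_module (length vs)) \<subseteq> generated (set vs)"
    unfolding combination_def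
    by (auto intro!: submodule_sum[OF submodule_generated] scale_in_generated)
qed

lemma submodule_Syz: "is_submodule (Syz (*s) vs)"
  using submodule_free_module[of "length vs"]
  by (auto simp: is_submodule_def Syz_def combination_diff combination_scale)


section \<open>Monomials and coefficients\<close>

lemma fst_shift [simp]: "fst (shift \<alpha> M) = \<alpha> + fst M"
  and snd_shift [simp]: "snd (shift \<alpha> M) = snd M"
  and shift_shift: "shift \<alpha> (shift \<beta> M) = shift (\<alpha> + \<beta>) M"
  and shift_zero [simp]: "shift 0 M = M"
  and shift_in_monoms [simp]: "shift \<alpha> M \<in> monoms p \<longleftrightarrow> M \<in> monoms p"
  by (auto simp: shift_def add.assoc monoms_def)

lemma coefficient_zero [simp]: "coefficient 0 M = 0"
  and coefficient_add: "coefficient (u + v) M = coefficient u M + coefficient v M"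
  and coefficient_sum: "coefficient (sum f T) M = (\<Sum>t\<in>T. coefficient (f t) M)"
  by (simp_all add: coefficient_def lookup_add lookup_sum)

lemma coefficient_diff:
  fixes u v :: "('x, 'a::comm_ring) mvec"
  shows "coefficient (u - v) M = coefficient u M - coefficient v M"
  by (simp add: coefficient_def lookup_minus)

lemma coefficient_eqI: "(\<And>M. coefficient u M = coefficient v M) \<Longrightarrow> u = v"
  by (auto intro!: poly_mapping_eqI simp: coefficient_def)

definition monomial :: "'x monom \<Rightarrow> 'a::zero \<Rightarrow> ('x, 'a) mvec"
  where "monomial M c = Poly_Mapping.single (snd M) (Poly_Mapping.single (fst M) c)"

lemma coefficient_monomial: "coefficient (monomial M c) N = (if N = M then c else 0)"
  by (auto simp: coefficient_def monomial_def lookup_single when_def prod_eq_iff)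

definition support :: "('x, 'a::zero) mvec \<Rightarrow> 'x monom set"
  where "support u = {M. coefficient u M \<noteq> 0}"

lemma in_support: "M \<in> support u \<longleftrightarrow> coefficient u M \<noteq> 0"
  by (simp add: support_def)

lemma finite_support: "finite (support u)"
proof (rule finite_subset)
  show "support u \<subseteq> (\<Union>i\<in>Poly_Mapping.keys u.
      (\<lambda>\<alpha>. (\<alpha>, i)) ` Poly_Mapping.keys (Poly_Mapping.lookup u i))"
    by (auto simp: support_def coefficient_def in_keys_iff image_iff)
qed auto

lemma support_nonempty: "u \<noteq> 0 \<Longrightarrow> support u \<noteq> {}"
  using coefficient_eqI[of u 0] by (auto simp: support_def)

lemma support_subset_monoms: "support u \<subseteq> monoms p \<longleftrightarrow> u \<in> carrier (free_module p)"
proof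
  assume *: "support u \<subseteq> monoms p"
  show "u \<in> carrier (free_module p)"
    unfolding carrier_free_module
  proof (intro allI impI)
    fix i assume "Poly_Mapping.lookup u i \<noteq> 0"
    then obtain \<alpha> where "Poly_Mapping.lookup (Poly_Mapping.lookup u i) \<alpha> \<noteq> 0"
      by (metis lookup_zero poly_mapping_eqI)
    then have "(\<alpha>, i) \<in> support u"
      by (simp add: support_def coefficient_def)
    with * show "i < p"
      by (auto simp: monoms_def)
  qed
next
  assume "u \<in> carrier (free_module p)"
  then show "support u \<subseteq> monoms p"
    by (auto simp: support_def coefficient_def monoms_def carrier_free_module)
      (metis lookup_zero)
qed

lemma support_in_monoms: "u \<in> carrier (free_module p) \<Longrightarrow> M \<in> support u \<Longrightarrow> M \<in> monoms p"
  using support_subset_monoms[of u p] by blast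

lemma sum_monomials:
  fixes u :: "('x, 'a::comm_ring) mvec"
  shows "(\<Sum>M\<in>support u. monomial M (coefficient u M)) = u"
  by (rule coefficient_eqI)
    (simp add: coefficient_sum coefficient_monomial finite_support in_support sum.delta)

lemma coefficient_monomial_scale:
  fixes u :: "('x, 'a::comm_ring) mvec"
  shows "coefficient (Poly_Mapping.single \<alpha> c *s u) (shift \<alpha> M) = c * coefficient u M"
  by (auto simp: coefficient_def lookup_monomial_times)

lemma coefficient_monomial_scale_nonzero:
  fixes u :: "('x, 'a::comm_ring) mvec"
  assumes "coefficient (Poly_Mapping.single \<alpha> c *s u) K \<noteq> 0"
  obtains M where "K = shift \<alpha> M" and "M \<in> support u"
proof -
  obtain \<beta> where "fst K = \<alpha> + \<beta>"
    using assms by (auto simp: coefficient_def lookup_monomial_times split: if_splits)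
  then have K: "K = shift \<alpha> (\<beta>, snd K)"
    by (simp add: shift_def prod_eq_iff)
  then have "coefficient u (\<beta>, snd K) \<noteq> 0"
    using assms by (metis coefficient_monomial_scale mult_zero_right)
  then show thesis using K that by (auto simp: in_support)
qed

lemma coefficient_scale_monomial:
  fixes c :: "'a::comm_ring"
  shows "coefficient (a *s monomial M c) K =
    (if \<exists>\<delta>. K = shift \<delta> M then Poly_Mapping.lookup a (fst K - fst M) * c else 0)"
proof -
  have "(\<exists>\<delta>. K = shift \<delta> M) \<longleftrightarrow> snd K = snd M \<and> (\<exists>\<beta>. fst K = fst M + \<beta>)"
    by (auto simp: shift_def prod_eq_iff add.commute)
  then show ?thesis
    by (auto simp: coefficient_def monomial_def lookup_single when_def mult.commute[of a]
        lookup_monomial_times mult.commute[of c])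
qed

lemma monomial_scale_monomial:
  "Poly_Mapping.single \<delta> a *s monomial M c = monomial (shift \<delta> M) (a * c)"
  unfolding monomial_def
  by (rule poly_mapping_eqI) (simp add: lookup_single when_def mult_single)

lemma combination_monomial:
  assumes "snd N < length vs"
  shows "combination (*s) vs (monomial N c) = Poly_Mapping.single (fst N) c *s vs ! snd N"
  using assms by (simp add: monomial_def combination_single)

text \<open>
  Applied to a list of vectors, this resolves a combination into one contribution for each monomial
  of the coefficient vector, which is what makes leading monomials of combinations accessible.
\<close>

lemma combination_expand:
  assumes "h \<in> carrier (free_module (length vs))"
  shows "combination (*s) vs h =
    (\<Sum>N\<in>support h. Poly_Mapping.single (fst N) (coefficient h N) *s vs ! snd N)"
proof -
  have "combination (*s) vs h =
      combination (*s) vs (\<Sum>N\<in>support h. monomial N (coefficient h N))"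
    by (simp only: sum_monomials)
  also have "\<dots> = (\<Sum>N\<in>support h. Poly_Mapping.single (fst N) (coefficient h N) *s vs ! snd N)"
    unfolding combination_sum
    using assms support_subset_monoms[of h "length vs"]
    by (intro sum.cong refl combination_monomial) (auto simp: monoms_def)
  finally show ?thesis .
qed


section \<open>Monomial orders\<close>

locale monomial_ordering =
  fixes p :: nat and gt :: "'x::finite monom_rel"
  assumes monomial_order: "monomial_order p gt"
begin

lemma gt_irrefl: "M \<in> monoms p \<Longrightarrow> \<not> gt M M"
  and gt_trans: "gt L M \<Longrightarrow> gt M N \<Longrightarrow> L \<in> monoms p \<Longrightarrow> M \<in> monoms p \<Longrightarrow> N \<in> monoms p \<Longrightarrow> gt L N"
  and gt_total: "M \<in> monoms p \<Longrightarrow> N \<in> monoms p \<Longrightarrow> M \<noteq> N \<Longrightarrow> gt M N \<or> gt N M"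
  and gt_shift: "M \<in> monoms p \<Longrightarrow> \<alpha> \<noteq> 0 \<Longrightarrow> gt (shift \<alpha> M) M"
  and shift_mono: "gt M N \<Longrightarrow> M \<in> monoms p \<Longrightarrow> N \<in> monoms p \<Longrightarrow> gt (shift \<alpha> M) (shift \<alpha> N)"
  using monomial_order unfolding monomial_order_def
  by (blast dest: irreflp_onD transp_onD totalp_onD)+

lemma gt_asym: "gt M N \<Longrightarrow> gt N M \<Longrightarrow> M \<in> monoms p \<Longrightarrow> N \<in> monoms p \<Longrightarrow> False"
  using gt_irrefl gt_trans by blast

text \<open>
  A monomial is never smaller than one of its divisors.  In going down, therefore, either the basis
  vector changes or some exponent drops.
\<close>

lemma gt_imp_not_multiple:
  assumes "gt M N" "M \<in> monoms p"
  shows "snd M \<noteq> snd N \<or> (\<exists>x. Poly_Mapping.lookup (fst N) x < Poly_Mapping.lookup (fst M) x)"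
proof (rule ccontr)
  assume "\<not> ?thesis"
  then have eq: "snd M = snd N"
    and le: "\<And>x. Poly_Mapping.lookup (fst M) x \<le> Poly_Mapping.lookup (fst N) x"
    by (auto simp: not_less)
  define \<delta> where "\<delta> = fst N - fst M"
  have "fst N = \<delta> + fst M"
    by (rule poly_mapping_eqI) (simp add: \<delta>_def lookup_add lookup_minus le)
  then have "N = shift \<delta> M"
    using eq by (simp add: shift_def prod_eq_iff)
  then have "N = M \<or> gt N M"
    using gt_shift[OF assms(2), of \<delta>] by (cases "\<delta> = 0") simp_all
  moreover have "N \<in> monoms p"
    using assms(2) \<open>N = shift \<delta> M\<close> by simp
  ultimately show False
    using assms gt_irrefl gt_asym by blast
qed

text \<open>
  In place of an appeal to Dickson's lemma: the order is transitive and, by the preceding lemma,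
  covered by finitely many well-founded relations, namely descent of the index of the basis vector, ascent of that
  index below \<open>p\<close>, and descent of the exponent of a fixed indeterminate.  Ramsey's theorem turns
  such a cover into well-foundedness.
\<close>

lemma wf_gt: "wf {(N, M). gt M N \<and> M \<in> monoms p \<and> N \<in> monoms p}"
  (is "wf ?R")
proof (rule trans_disj_wf_implies_wf)
  show "trans ?R"
    by (rule transI) (use gt_trans in blast)
  define T where "T i = (if i = 0 then measure snd
      else if i = 1 then measure (\<lambda>M. p - snd M)
      else measure (\<lambda>M. Poly_Mapping.lookup (fst M) (from_nat_into UNIV (i - 2) :: 'x)))"
    for i :: nat
  let ?n = "CARD('x) + 2"
  have "wf (T i)" for i by (simp add: T_def)
  moreover have "?R \<subseteq> (\<Union>i<?n. T i)"
  proof clarify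
    fix M N assume gt: "gt M N" and M: "M \<in> monoms p" and N: "N \<in> monoms p"
    show "(N, M) \<in> (\<Union>i<?n. T i)"
    proof (cases "snd M = snd N")
      case False
      then have "(N, M) \<in> T 0 \<or> (N, M) \<in> T 1"
        using M N by (auto simp: T_def monoms_def)
      then show ?thesis by auto
    next
      case True
      then obtain x where x: "Poly_Mapping.lookup (fst N) x < Poly_Mapping.lookup (fst M) x"
        using gt_imp_not_multiple[OF gt M] by auto
      let ?i = "to_nat_on UNIV x"
      have "?i < CARD('x)"
        using to_nat_on_finite[of "UNIV :: 'x set"] by (auto simp: bij_betw_def)
      moreover have "(N, M) \<in> T (?i + 2)"
        using x by (simp add: T_def countable_finite)
      ultimately show ?thesis by fastforce
    qed
  qed
  ultimately show "disj_wf ?R"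
    unfolding disj_wf by blast
qed

lemma monom_induct [consumes 1, case_names less]:
  assumes "M \<in> monoms p"
    and "\<And>M. M \<in> monoms p \<Longrightarrow> (\<And>N. gt M N \<Longrightarrow> N \<in> monoms p \<Longrightarrow> P N) \<Longrightarrow> P M"
  shows "P M"
  using assms(1) by (induction M rule: wf_induct_rule[OF wf_gt]) (use assms(2) in blast)

lemma ex_greatest:
  assumes "finite S" "S \<noteq> {}" "S \<subseteq> monoms p"
  shows "\<exists>M\<in>S. \<forall>N\<in>S. N \<noteq> M \<longrightarrow> gt M N"
  using assms
proof (induction S rule: finite_ne_induct)
  case (insert K S)
  then obtain M where M: "M \<in> S" "\<forall>N\<in>S. N \<noteq> M \<longrightarrow> gt M N" by auto
  show ?case
  proof (cases "gt K M")
    case True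
    then have "gt K N" if "N \<in> S" for N
      using that M insert.prems gt_trans[of K M N] by (cases "N = M") auto
    then show ?thesis by auto
  next
    case False
    then have "K = M \<or> gt M K"
      using gt_total[of K M] M insert.prems by auto
    then show ?thesis using M by auto
  qed
qed auto

lemma LM_eqI:
  assumes "u \<in> carrier (free_module p)" and "M \<in> support u"
    and "\<And>N. N \<in> support u \<Longrightarrow> N \<noteq> M \<Longrightarrow> gt M N"
  shows "LM gt u = M"
proof -
  have sub: "support u \<subseteq> monoms p"
    using support_in_monoms[OF assms(1)] by blast
  have unique: "N = M" if N: "N \<in> support u" "\<forall>K\<in>support u. K \<noteq> N \<longrightarrow> gt N K" for N
  proof (rule ccontr)
    assume "N \<noteq> M"
    then have "gt M N" "gt N M"
      using N assms(2,3) by auto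
    then show False
      using gt_asym N(1) assms(2) sub by (meson subsetD)
  qed
  show ?thesis
    unfolding LM_def
  proof (rule the_equality)
    show "coefficient u M \<noteq> 0 \<and> (\<forall>N. coefficient u N \<noteq> 0 \<and> N \<noteq> M \<longrightarrow> gt M N)"
      using assms(2,3) by (simp add: in_support)
    show "N = M" if "coefficient u N \<noteq> 0 \<and> (\<forall>K. coefficient u K \<noteq> 0 \<and> K \<noteq> N \<longrightarrow> gt N K)" for N
      by (rule unique) (use that in \<open>auto simp: in_support\<close>)
  qed
qed

lemma
  assumes "u \<in> carrier (free_module p)" and "u \<noteq> 0"
  shows LM_in_support: "LM gt u \<in> support u"
    and LM_greatest: "N \<in> support u \<Longrightarrow> N \<noteq> LM gt u \<Longrightarrow> gt (LM gt u) N"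
proof -
  have sub: "support u \<subseteq> monoms p"
    using support_in_monoms[OF assms(1)] by blast
  then obtain M where M: "M \<in> support u" "\<forall>N\<in>support u. N \<noteq> M \<longrightarrow> gt M N"
    using ex_greatest[OF finite_support support_nonempty[OF assms(2)]] by blast
  then have "LM gt u = M"
    by (intro LM_eqI assms(1)) auto
  with M show "LM gt u \<in> support u"
    and "N \<in> support u \<Longrightarrow> N \<noteq> LM gt u \<Longrightarrow> gt (LM gt u) N"
    by auto
qed

lemma LM_in_monoms: "u \<in> carrier (free_module p) \<Longrightarrow> u \<noteq> 0 \<Longrightarrow> LM gt u \<in> monoms p"
  by (rule support_in_monoms[OF _ LM_in_support])

lemma LT_eq: "u \<noteq> 0 \<Longrightarrow> LT gt u = monomial (LM gt u) (coefficient u (LM gt u))"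
  by (simp add: LT_def monomial_def)

end


section \<open>Division by a Groebner basis\<close>

text \<open>
  Leading terms of combinations of \<open>G\<close> are controlled by the leading monomials \<open>lm i\<close> and leading
  coefficients \<open>lc i\<close> of its entries.  The image monomial of \<open>X\<^sup>\<alpha> \<epsilon>\<^sub>i\<close> is the leading monomial of
  \<open>X\<^sup>\<alpha> G ! i\<close>.
\<close>

locale vector_list = monomial_ordering p gt
  for p and gt :: "'x::finite monom_rel" +
  fixes G :: "('x, 'a::{comm_ring, comm_monoid_mult}) mvec list"
  assumes G_carrier: "set G \<subseteq> carrier (free_module p) - {0}"
begin

definition lm :: "nat \<Rightarrow> 'x monom" where "lm i = LM gt (G ! i)"
definition lc :: "nat \<Rightarrow> 'a" where "lc i = coefficient (G ! i) (lm i)"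

definition image_monom :: "'x monom \<Rightarrow> 'x monom" where "image_monom N = shift (fst N) (lm (snd N))"

lemma
  assumes "i < length G"
  shows lm_in_monoms: "lm i \<in> monoms p"
    and lc_nonzero: "lc i \<noteq> 0"
    and lm_greatest: "N \<in> support (G ! i) \<Longrightarrow> N \<noteq> lm i \<Longrightarrow> gt (lm i) N"
    and nth_support: "support (G ! i) \<subseteq> monoms p"
proof -
  have *: "G ! i \<in> carrier (free_module p)" "G ! i \<noteq> 0"
    using G_carrier nth_mem[OF assms] by auto
  show "lm i \<in> monoms p" "lc i \<noteq> 0"
    using LM_in_monoms[OF *] LM_in_support[OF *] by (simp_all add: lm_def lc_def in_support)
  show "N \<in> support (G ! i) \<Longrightarrow> N \<noteq> lm i \<Longrightarrow> gt (lm i) N"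
    unfolding lm_def by (rule LM_greatest[OF *])
  show "support (G ! i) \<subseteq> monoms p"
    using support_in_monoms[OF *(1)] by blast
qed

lemma image_monom_in_monoms: "N \<in> monoms (length G) \<Longrightarrow> image_monom N \<in> monoms p"
  by (auto simp: image_monom_def monoms_def[of "length G"] lm_in_monoms)

lemma image_monom_shift: "image_monom (shift \<alpha> N) = shift \<alpha> (image_monom N)"
  by (simp add: image_monom_def shift_shift)

lemma coefficient_scaled_nth:
  "coefficient (Poly_Mapping.single (fst N) c *s G ! snd N) (image_monom N) = c * lc (snd N)"
  by (simp add: image_monom_def coefficient_monomial_scale lc_def)

lemma coefficient_scaled_nth_nonzero:
  assumes "N \<in> monoms (length G)"
    and "coefficient (Poly_Mapping.single (fst N) c *s G ! snd N) K \<noteq> 0"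
  shows "K = image_monom N \<or> gt (image_monom N) K"
proof -
  have i: "snd N < length G"
    using assms(1) by (auto simp: monoms_def)
  obtain L where L: "K = shift (fst N) L" "L \<in> support (G ! snd N)"
    using assms(2) by (rule coefficient_monomial_scale_nonzero)
  show ?thesis
  proof (cases "L = lm (snd N)")
    case True then show ?thesis by (simp add: L image_monom_def)
  next
    case False
    then have "gt (lm (snd N)) L" using lm_greatest[OF i] L by blast
    then have "gt (image_monom N) K"
      unfolding L image_monom_def
      by (rule shift_mono) (use lm_in_monoms[OF i] nth_support[OF i] L in auto)
    then show ?thesis ..
  qed
qed

text \<open>
  When no term of \<open>h\<close> has an image monomial above \<open>M\<close>, the coefficient at \<open>M\<close> comes from leading
  terms alone: terms with smaller image monomials do not reach \<open>M\<close>.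
\<close>

lemma coefficient_combination:
  assumes h: "h \<in> carrier (free_module (length G))" and M: "M \<in> monoms p"
    and le: "\<And>N. N \<in> support h \<Longrightarrow> image_monom N = M \<or> gt M (image_monom N)"
  shows "coefficient (combination (*s) G h) M =
      (\<Sum>N | N \<in> support h \<and> image_monom N = M. coefficient h N * lc (snd N))"
    and "K \<in> support (combination (*s) G h) \<Longrightarrow> K = M \<or> gt M K"
proof -
  let ?c = "\<lambda>N. coefficient (Poly_Mapping.single (fst N) (coefficient h N) *s G ! snd N)"
  have sub: "support h \<subseteq> monoms (length G)"
    using support_in_monoms[OF h] by blast
  have coeff: "coefficient (combination (*s) G h) K = (\<Sum>N\<in>support h. ?c N K)" for K
    by (simp add: combination_expand[OF h] coefficient_sum)
  have zero: "?c N M = 0" if N: "N \<in> support h" "image_monom N \<noteq> M" for N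
  proof (rule ccontr)
    assume "?c N M \<noteq> 0"
    then have "gt (image_monom N) M"
      using coefficient_scaled_nth_nonzero[of N _ M] N sub by blast
    then show False
      using le N sub gt_asym[of M "image_monom N"] M image_monom_in_monoms by blast
  qed
  have "(\<Sum>N\<in>support h. ?c N M) = (\<Sum>N | N \<in> support h \<and> image_monom N = M. ?c N M)"
    using zero by (intro sum.mono_neutral_right) (auto simp: finite_support)
  also have "\<dots> = (\<Sum>N | N \<in> support h \<and> image_monom N = M. coefficient h N * lc (snd N))"
    by (intro sum.cong refl) (metis (mono_tags, lifting) coefficient_scaled_nth mem_Collect_eq)
  finally show "coefficient (combination (*s) G h) M = \<dots>"
    by (simp add: coeff)
  assume K: "K \<in> support (combination (*s) G h)"
  then have "(\<Sum>N\<in>support h. ?c N K) \<noteq> 0"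
    by (simp add: coeff in_support)
  then obtain N where N: "N \<in> support h" "?c N K \<noteq> 0"
    by (rule sum.not_neutral_contains_not_neutral)
  then have "N \<in> monoms (length G)"
    using sub by blast
  then have "K = image_monom N \<or> gt (image_monom N) K" and "image_monom N \<in> monoms p"
    using coefficient_scaled_nth_nonzero[OF _ N(2)] image_monom_in_monoms by auto
  moreover have "combination (*s) G h \<in> carrier (free_module p)"
    using G_carrier by (intro submodule_combination submodule_free_module) auto
  then have "K \<in> monoms p"
    using K by (rule support_in_monoms)
  ultimately show "K = M \<or> gt M K"
    using le[OF N(1)] M gt_trans[of M "image_monom N" K] by metis
qed

definition divisors :: "'x monom \<Rightarrow> nat set"
  where "divisors M = {i. i < length G \<and> (\<exists>\<delta>. M = shift \<delta> (lm i))}"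

text \<open>
  All terms of this coefficient vector have image monomial \<open>M\<close> (for \<open>E \<subseteq> divisors M\<close>), so that their
  leading terms add up at \<open>M\<close>.
\<close>

definition homogeneous_vector :: "'x monom \<Rightarrow> nat set \<Rightarrow> (nat \<Rightarrow> 'a) \<Rightarrow> ('x, 'a) mvec"
  where "homogeneous_vector M E b = (\<Sum>j\<in>E. monomial (fst M - fst (lm j), j) (b j))"

lemma finite_divisors: "finite (divisors M)"
  by (simp add: divisors_def)

lemma coefficient_homogeneous_vector:
  assumes "finite E"
  shows "coefficient (homogeneous_vector M E b) N =
    (if snd N \<in> E \<and> fst N = fst M - fst (lm (snd N)) then b (snd N) else 0)"
proof -
  have "coefficient (homogeneous_vector M E b) N =
      (\<Sum>j\<in>E. if j = snd N then (if fst N = fst M - fst (lm (snd N)) then b (snd N) else 0) else 0)"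
    unfolding homogeneous_vector_def coefficient_sum
    by (intro sum.cong) (auto simp: coefficient_monomial prod_eq_iff)
  then show ?thesis
    using assms by simp
qed

lemma
  assumes E: "E \<subseteq> divisors M" and M: "M \<in> monoms p"
  shows homogeneous_vector_carrier:
      "homogeneous_vector M E b \<in> carrier (free_module (length G))"
    and image_monom_homogeneous_vector:
      "N \<in> support (homogeneous_vector M E b) \<Longrightarrow> image_monom N = M"
    and coefficient_combination_homogeneous_vector:
      "coefficient (combination (*s) G (homogeneous_vector M E b)) M = (\<Sum>j\<in>E. b j * lc j)"
    and support_combination_homogeneous_vector:
      "K \<in> support (combination (*s) G (homogeneous_vector M E b)) \<Longrightarrow> K = M \<or> gt M K"
proof -
  let ?h = "homogeneous_vector M E b"
  have fin: "finite E"
    using E finite_divisors finite_subset by blast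
  have supp: "support ?h = (\<lambda>j. (fst M - fst (lm j), j)) ` {j\<in>E. b j \<noteq> 0}"
    by (auto simp: support_def coefficient_homogeneous_vector[OF fin] image_iff)
  have "support ?h \<subseteq> monoms (length G)"
    using E by (auto simp: supp divisors_def monoms_def)
  then show car: "?h \<in> carrier (free_module (length G))"
    by (rule iffD1[OF support_subset_monoms])
  have img: "image_monom (fst M - fst (lm j), j) = M" if "j \<in> E" for j
    using that E by (auto simp: divisors_def image_monom_def)
  then show eq: "N \<in> support ?h \<Longrightarrow> image_monom N = M" for N
    by (auto simp: supp)
  show "K \<in> support (combination (*s) G ?h) \<Longrightarrow> K = M \<or> gt M K"
    by (rule coefficient_combination(2)[OF car M]) (use eq in auto)
  have "coefficient (combination (*s) G ?h) M =
      (\<Sum>N | N \<in> support ?h \<and> image_monom N = M. coefficient ?h N * lc (snd N))"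
    by (rule coefficient_combination(1)[OF car M]) (use eq in auto)
  also have "\<dots> = (\<Sum>N\<in>support ?h. coefficient ?h N * lc (snd N))"
    using eq by (intro sum.cong) auto
  also have "\<dots> = (\<Sum>j\<in>{j\<in>E. b j \<noteq> 0}. b j * lc j)"
    unfolding supp
    by (subst sum.reindex) (auto simp: inj_on_def coefficient_homogeneous_vector[OF fin])
  also have "\<dots> = (\<Sum>j\<in>E. b j * lc j)"
    using fin by (intro sum.mono_neutral_left) auto
  finally show "coefficient (combination (*s) G ?h) M = (\<Sum>j\<in>E. b j * lc j)" .
qed

text \<open>
  Comparing coefficients at \<open>M\<close> turns membership in a module generated by terms into a statement
  about the ground ring.
\<close>

lemma leading_term_in_generatedD:
  assumes "monomial M c \<in> generated (LT gt ` set G)"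
  obtains b where "c = (\<Sum>j\<in>divisors M. b j * lc j)"
proof -
  have "monomial M c \<in> combination (*s) (map (LT gt) G) ` carrier (free_module (length G))"
    using assms generated_list[of "map (LT gt) G"] by simp
  then obtain a where a: "monomial M c = (\<Sum>i<length G. Poly_Mapping.lookup a i *s LT gt (G ! i))"
    by (auto simp: combination_def)
  have LT: "LT gt (G ! i) = monomial (lm i) (lc i)" if "i < length G" for i
    unfolding lm_def lc_def by (rule LT_eq) (use G_carrier nth_mem[OF that] in auto)
  let ?b = "\<lambda>j. Poly_Mapping.lookup (Poly_Mapping.lookup a j) (fst M - fst (lm j))"
  have "c = coefficient (monomial M c) M"
    by (simp add: coefficient_monomial)
  also have "\<dots> = (\<Sum>i<length G. if \<exists>\<delta>. M = shift \<delta> (lm i) then ?b i * lc i else 0)"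
    unfolding a coefficient_sum
    by (intro sum.cong refl) (simp add: LT coefficient_scale_monomial)
  also have "\<dots> = (\<Sum>i\<in>divisors M. ?b i * lc i)"
    by (rule sum.mono_neutral_cong_right) (auto simp: divisors_def)
  finally show thesis by (rule that)
qed

end

text \<open>
  This is the working form of a Groebner basis.  That \<open>G\<close> generates \<open>W\<close> is a consequence of
  division.
\<close>

locale leading_basis = vector_list p gt G
  for p and gt :: "'x::finite monom_rel" and G :: "('x, 'a::{comm_ring, comm_monoid_mult}) mvec list" +
  fixes W
  assumes submodule: "is_submodule W"
    and W_carrier: "W \<subseteq> carrier (free_module p)"
    and G_subset: "set G \<subseteq> W"
    and LT_generated: "u \<in> W \<Longrightarrow> u \<noteq> 0 \<Longrightarrow> LT gt u \<in> generated (LT gt ` set G)"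
begin

text \<open>
  Division by \<open>G\<close>, by well-founded induction on a strict bound for the monomials of \<open>u\<close>: subtracting
  a combination of multiples of entries of \<open>G\<close> that have the leading monomial of \<open>u\<close> removes the
  leading term, and then the old leading monomial is a strict bound.  The bound on the image
  monomials of the quotients is what the construction of syzygies needs.
\<close>

lemma division:
  assumes "M \<in> monoms p" "u \<in> W" "\<And>K. K \<in> support u \<Longrightarrow> gt M K"
  shows "\<exists>h\<in>carrier (free_module (length G)).
    combination (*s) G h = u \<and> (\<forall>N\<in>support h. gt M (image_monom N))"
  using assms
proof (induction M arbitrary: u rule: monom_induct)
  case (less M)
  show ?case
  proof (cases "u = 0")
    case True
    then show ?thesis
      by (intro bexI[of _ 0]) (auto simp: in_support carrier_free_module)
  next
    case False
    define L where "L = LM gt u"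
    have u: "u \<in> carrier (free_module p)"
      using less.prems W_carrier by blast
    have L: "L \<in> support u" "L \<in> monoms p" "gt M L"
      using LM_in_support[OF u False] LM_in_monoms[OF u False] less.prems by (auto simp: L_def)
    obtain b where b: "coefficient u L = (\<Sum>j\<in>divisors L. b j * lc j)"
      using LT_generated[OF less.prems(1) False] leading_term_in_generatedD
      by (metis LT_eq[OF False] L_def)
    define h where "h = homogeneous_vector L (divisors L) b"
    note hv = homogeneous_vector_carrier[OF order_refl L(2)]
      image_monom_homogeneous_vector[OF order_refl L(2)]
      coefficient_combination_homogeneous_vector[OF order_refl L(2)]
      support_combination_homogeneous_vector[OF order_refl L(2)]
    define v where "v = u - combination (*s) G h"
    have vL: "coefficient v L = 0"
      by (simp add: v_def coefficient_diff b h_def hv)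
    have v: "v \<in> W"
      unfolding v_def
      using less.prems G_subset submodule by (intro submodule_diff submodule_combination)
    have gt: "gt L K" if "K \<in> support v" for K
    proof (rule ccontr)
      assume *: "\<not> gt L K"
      have "K \<noteq> L" using that vL by (auto simp: in_support)
      then have "K \<notin> support u" "K \<notin> support (combination (*s) G h)"
        using * LM_greatest[OF u False] hv(4) unfolding L_def h_def by blast+
      then show False using that by (simp add: v_def in_support coefficient_diff)
    qed
    obtain h' where h': "h' \<in> carrier (free_module (length G))" "combination (*s) G h' = v"
        "\<forall>N\<in>support h'. gt L (image_monom N)"
      using less.IH[OF L(3) L(2) v gt] by blast
    have car: "h + h' \<in> carrier (free_module (length G))"
      using hv(1) h'(1) submodule_add[OF submodule_free_module] by (auto simp: h_def)
    moreover have "combination (*s) G (h + h') = u"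
      by (simp add: combination_add h' v_def)
    moreover have "gt M (image_monom N)" if N: "N \<in> support (h + h')" for N
    proof -
      have "N \<in> support h \<or> N \<in> support h'"
        using N by (auto simp: in_support coefficient_add)
      then have "image_monom N = L \<or> gt L (image_monom N)"
        using hv(2) h'(3) unfolding h_def by blast
      moreover have "image_monom N \<in> monoms p"
        by (rule image_monom_in_monoms[OF support_in_monoms[OF car N]])
      ultimately show ?thesis
        using L less.hyps gt_trans[of M L "image_monom N"] by auto
    qed
    ultimately show ?thesis by blast
  qed
qed

lemma generates: "W = generated (set G)"
proof
  show "generated (set G) \<subseteq> W"
    using G_subset by (intro generated_least submodule submodule_scale) auto
  show "W \<subseteq> generated (set G)"
  proof
    fix u assume u: "u \<in> W"
    show "u \<in> generated (set G)"
    proof (cases "u = 0")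
      case True then show ?thesis using submodule_zero[OF submodule_generated] by simp
    next
      case False
      have uc: "u \<in> carrier (free_module p)" using u W_carrier by blast
      \<comment> \<open>Division needs a strict bound: any proper multiple of the leading monomial will do.\<close>
      define \<delta> :: "'x \<Rightarrow>\<^sub>0 nat" where "\<delta> = Poly_Mapping.single undefined 1"
      have "\<delta> \<noteq> 0" by (metis \<delta>_def lookup_single_eq lookup_zero one_neq_zero)
      define L where "L = LM gt u"
      have L: "L \<in> monoms p" and gtL: "gt (shift \<delta> L) L"
        using LM_in_monoms[OF uc False] \<open>\<delta> \<noteq> 0\<close> gt_shift by (auto simp: L_def)
      have "gt (shift \<delta> L) K" if "K \<in> support u" for K
      proof (cases "K = L")
        case False
        then have "gt L K" using LM_greatest[OF uc \<open>u \<noteq> 0\<close>] that by (auto simp: L_def)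
        moreover have "K \<in> monoms p" by (rule support_in_monoms[OF uc that])
        ultimately show ?thesis using gt_trans[OF gtL] L by auto
      qed (use gtL in simp)
      then obtain h where "h \<in> carrier (free_module (length G))" "combination (*s) G h = u"
        using division[of "shift \<delta> L" u] L u by auto
      then show ?thesis by (auto simp: generated_list)
    qed
  qed
qed

lemma groebner: "groebner_basis p gt G W"
  unfolding groebner_basis_def
proof (intro conjI)
  show "MLT gt W = generated (LT gt ` set G)"
    unfolding MLT_def
  proof
    show "generated (LT gt ` set G) \<subseteq> generated (LT gt ` W)"
      using G_subset by (intro generated_mono) auto
    show "generated (LT gt ` W) \<subseteq> generated (LT gt ` set G)"
    proof (rule generated_least[OF submodule_generated])
      fix c v assume "v \<in> LT gt ` W"
      then obtain u where u: "u \<in> W" "v = LT gt u" by auto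
      then have "v \<in> generated (LT gt ` set G)"
        using LT_generated[of u] submodule_zero[OF submodule_generated]
        by (cases "u = 0") (auto simp: LT_def)
      then show "c *s v \<in> generated (LT gt ` set G)"
        by (rule submodule_scale[OF submodule_generated])
    qed
  qed
qed (rule G_carrier generates)+

end


section \<open>Schreyer's order\<close>

context vector_list
begin

abbreviation schreyer :: "'x monom_rel" where "schreyer \<equiv> schreyer_order gt G"

text \<open>
  Schreyer's order is defined by the leading monomials of the vectors \<open>X\<^sup>\<alpha> g\<^sub>i\<close>; these are the image
  monomials.
\<close>

lemma LM_scaled_nth:
  assumes "i < length G"
  shows "LM gt (Poly_Mapping.single \<alpha> 1 *s G ! i) = shift \<alpha> (lm i)"
proof (rule LM_eqI)
  have "G ! i \<in> carrier (free_module p)"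
    using G_carrier nth_mem[OF assms] by auto
  then show "Poly_Mapping.single \<alpha> 1 *s G ! i \<in> carrier (free_module p)"
    by (rule submodule_scale[OF submodule_free_module])
  show "shift \<alpha> (lm i) \<in> support (Poly_Mapping.single \<alpha> 1 *s G ! i)"
    using lc_nonzero[OF assms] by (simp add: in_support coefficient_monomial_scale lc_def)
  show "gt (shift \<alpha> (lm i)) N"
    if "N \<in> support (Poly_Mapping.single \<alpha> 1 *s G ! i)" "N \<noteq> shift \<alpha> (lm i)" for N
    using that coefficient_scaled_nth_nonzero[of "(\<alpha>, i)" 1 N] assms
    by (auto simp: in_support monoms_def image_monom_def)
qed

lemma schreyer_iff:
  assumes "M \<in> monoms (length G)" "N \<in> monoms (length G)"
  shows "schreyer M N \<longleftrightarrow>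
    gt (image_monom M) (image_monom N) \<or> image_monom M = image_monom N \<and> snd M < snd N"
  using assms
  by (cases M; cases N) (simp add: schreyer_order_def monoms_def LM_scaled_nth image_monom_def Let_def)

lemma image_monom_inj: "image_monom M = image_monom N \<Longrightarrow> snd M = snd N \<Longrightarrow> M = N"
  by (simp add: image_monom_def prod_eq_iff)

lemma schreyer_monomial_ordering: "monomial_ordering (length G) schreyer"
proof
  let ?F = "monoms (length G) :: 'x monom set"
  note image = image_monom_in_monoms
  show "monomial_order (length G) schreyer"
    unfolding monomial_order_def
  proof (intro conjI ballI allI impI)
    show "irreflp_on ?F schreyer"
      by (rule irreflp_onI) (simp add: schreyer_iff gt_irrefl image)
    show "transp_on ?F schreyer"
    proof (rule transp_onI)
      fix L M N assume *: "L \<in> ?F" "M \<in> ?F" "N \<in> ?F" "schreyer L M" "schreyer M N"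
      then show "schreyer L N"
        using gt_trans[of "image_monom L" "image_monom M" "image_monom N"] image[of L] image[of M]
          image[of N] by (simp add: schreyer_iff) (metis less_trans)
    qed
    show "totalp_on ?F schreyer"
    proof (rule totalp_onI)
      fix M N assume *: "M \<in> ?F" "N \<in> ?F" "M \<noteq> N"
      then show "schreyer M N \<or> schreyer N M"
        using image_monom_inj[of M N] gt_total[of "image_monom M" "image_monom N"]
          image[of M] image[of N] by (simp add: schreyer_iff) (metis linorder_neqE_nat)
    qed
    show "schreyer (shift \<alpha> M) M" if "M \<in> ?F" "\<alpha> \<noteq> 0" for M \<alpha>
      using that gt_shift[OF image[of M]] by (simp add: schreyer_iff image_monom_shift)
    show "schreyer (shift \<alpha> M) (shift \<alpha> N)" if "M \<in> ?F" "N \<in> ?F" "schreyer M N" for M N \<alpha>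
      using that shift_mono[OF _ image[of M] image[of N]]
      by (auto simp: schreyer_iff image_monom_shift)
  qed
qed

end

sublocale vector_list \<subseteq> schreyer: monomial_ordering "length G" "schreyer_order gt G"
  by (rule schreyer_monomial_ordering)

text \<open>
  A relation between leading coefficients lifts to a syzygy: the relation cancels the term at \<open>M\<close>
  of the homogeneous combination, and division expresses the rest by terms with image monomial
  below \<open>M\<close>, which are smaller in Schreyer's order than the terms of the homogeneous vector.  Among
  the latter the least index leads.
\<close>

lemma (in leading_basis) ex_syzygy_with_leading_term:
  assumes E: "E \<subseteq> divisors M" and M: "M \<in> monoms p"
    and relation: "(\<Sum>j\<in>E. b j * lc j) = 0"
    and i: "i \<in> E" "b i \<noteq> 0" "\<And>j. j \<in> E \<Longrightarrow> i \<le> j"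
  shows "\<exists>t\<in>Syz (*s) G - {0}. LM schreyer t = (fst M - fst (lm i), i) \<and>
    LT schreyer t = monomial (fst M - fst (lm i), i) (b i)"
proof -
  define h where "h = homogeneous_vector M E b"
  let ?N = "(fst M - fst (lm i), i)"
  note h = homogeneous_vector_carrier[OF E M, of b, folded h_def]
    image_monom_homogeneous_vector[OF E M, of _ b, folded h_def]
    coefficient_combination_homogeneous_vector[OF E M, of b, folded h_def]
    support_combination_homogeneous_vector[OF E M, of _ b, folded h_def]
  have fin: "finite E"
    using E finite_divisors finite_subset by blast
  note coeff = coefficient_homogeneous_vector[OF fin, of M b, folded h_def]
  have "combination (*s) G h \<in> W"
    by (rule submodule_combination[OF submodule G_subset])
  moreover have "gt M K" if K: "K \<in> support (combination (*s) G h)" for K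
  proof -
    have "K \<noteq> M" using K h(3) relation by (auto simp: in_support)
    then show ?thesis using h(4)[OF K] by simp
  qed
  ultimately obtain h' where h': "h' \<in> carrier (free_module (length G))"
      "combination (*s) G h' = combination (*s) G h" "\<forall>N\<in>support h'. gt M (image_monom N)"
    using division[OF M] by blast
  define t where "t = h - h'"
  have t_carrier: "t \<in> carrier (free_module (length G))"
    unfolding t_def by (rule submodule_diff[OF submodule_free_module h(1) h'(1)])
  then have t_Syz: "t \<in> Syz (*s) G"
    by (simp add: Syz_def t_def combination_diff h'(2))
  have "?N \<in> support h"
    using i by (simp add: in_support coeff)
  then have image_N: "image_monom ?N = M"
    by (rule h(2))
  have "?N \<notin> support h'"
    using h'(3) image_N gt_irrefl[OF M] by auto
  then have coeff_N: "coefficient t ?N = b i"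
    using i by (simp add: t_def coefficient_diff in_support coeff)
  have LM_t: "LM schreyer t = ?N"
  proof (rule schreyer.LM_eqI[OF t_carrier])
    show supp_N: "?N \<in> support t"
      using i coeff_N by (simp add: in_support)
    fix K assume K: "K \<in> support t" "K \<noteq> ?N"
    have "gt M (image_monom K) \<or> image_monom K = M \<and> i < snd K"
    proof (cases "K \<in> support h'")
      case False
      then have K': "K \<in> support h"
        using K by (simp add: t_def in_support coefficient_diff)
      then have "snd K \<in> E" "fst K = fst M - fst (lm (snd K))"
        by (auto simp: in_support coeff split: if_splits)
      then have "snd K \<noteq> i" "i \<le> snd K"
        using K i(3) by (auto simp: prod_eq_iff)
      then show ?thesis
        using h(2)[OF K'] by simp
    qed (use h'(3) in auto)
    then show "schreyer ?N K"
      using schreyer_iff[of ?N K] support_in_monoms[OF t_carrier] K supp_N image_N by auto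
  qed
  have "t \<noteq> 0"
    using coeff_N i by auto
  then show ?thesis
    using t_Syz LM_t coeff_N schreyer.LT_eq[of t] by auto
qed


section \<open>Finite generation of the leading terms of syzygies\<close>

lemma exponent_divides_iff:
  fixes \<beta> \<gamma> :: "'x \<Rightarrow>\<^sub>0 nat"
  shows "(\<exists>\<delta>. \<gamma> = \<delta> + \<beta>) \<longleftrightarrow> (\<forall>x. Poly_Mapping.lookup \<beta> x \<le> Poly_Mapping.lookup \<gamma> x)"
proof
  assume "\<forall>x. Poly_Mapping.lookup \<beta> x \<le> Poly_Mapping.lookup \<gamma> x"
  then have "\<gamma> = (\<gamma> - \<beta>) + \<beta>"
    by (intro poly_mapping_eqI) (simp add: lookup_add lookup_minus)
  then show "\<exists>\<delta>. \<gamma> = \<delta> + \<beta>" ..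
qed (auto simp: lookup_add)

definition exponent_lcm :: "('x::finite \<Rightarrow>\<^sub>0 nat) set \<Rightarrow> 'x \<Rightarrow>\<^sub>0 nat"
  where "exponent_lcm B = Abs_poly_mapping (\<lambda>x. Max ((\<lambda>\<beta>. Poly_Mapping.lookup \<beta> x) ` B))"

lemma lookup_exponent_lcm:
  "Poly_Mapping.lookup (exponent_lcm B) x = Max ((\<lambda>\<beta>. Poly_Mapping.lookup \<beta> x) ` B)"
  by (simp add: exponent_lcm_def)

lemma monomial_sum:
  fixes f :: "'b \<Rightarrow> 'a::comm_ring"
  shows "monomial M (sum f T) = (\<Sum>t\<in>T. monomial M (f t))"
  by (rule coefficient_eqI) (simp add: coefficient_sum coefficient_monomial)

lemma monomial_zero [simp]: "monomial M (0 :: 'a::comm_ring) = 0"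
  by (simp add: monomial_def)

context leading_basis
begin

lemma divisors_iff:
  "j \<in> divisors M \<longleftrightarrow> j < length G \<and> snd (lm j) = snd M \<and>
    (\<forall>x. Poly_Mapping.lookup (fst (lm j)) x \<le> Poly_Mapping.lookup (fst M) x)"
  unfolding divisors_def exponent_divides_iff[symmetric] by (auto simp: shift_def prod_eq_iff)

text \<open>
  The leading monomials of the entries with index in \<open>E\<close> have a common multiple exactly if they
  involve the same basis vector.
\<close>

definition aligned :: "nat set \<Rightarrow> bool"
  where "aligned E \<longleftrightarrow> E \<noteq> {} \<and> E \<subseteq> {..<length G} \<and> (\<exists>e. \<forall>j\<in>E. snd (lm j) = e)"

definition lcm_monom :: "nat set \<Rightarrow> 'x monom"
  where "lcm_monom E = (exponent_lcm ((\<lambda>j. fst (lm j)) ` E), snd (lm (Min E)))"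

text \<open>
  The leading coefficients outside \<open>E\<close> are replaced by \<open>0\<close> instead of being left out.  This keeps the
  indices in place; the components outside \<open>E\<close> of a relation are then arbitrary.
\<close>

definition restricted_lcs :: "nat set \<Rightarrow> 'a list"
  where "restricted_lcs E = map (\<lambda>j. if j \<in> E then lc j else 0) [0..<length G]"

definition leading_candidate :: "nat set \<Rightarrow> 'x monom"
  where "leading_candidate E = (fst (lcm_monom E) - fst (lm (Min E)), Min E)"

lemma aligned_finite: "aligned E \<Longrightarrow> finite E"
  unfolding aligned_def using finite_subset by blast

lemma aligned_Min: "aligned E \<Longrightarrow> Min E \<in> E"
  using Min_in[of E] aligned_finite[of E] by (simp add: aligned_def)

lemma aligned_snd: "aligned E \<Longrightarrow> j \<in> E \<Longrightarrow> snd (lm j) = snd (lm (Min E))"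
  using aligned_Min[of E] by (auto simp: aligned_def)

lemma lookup_lcm_monom:
  "Poly_Mapping.lookup (fst (lcm_monom E)) x = Max ((\<lambda>j. Poly_Mapping.lookup (fst (lm j)) x) ` E)"
  by (simp add: lcm_monom_def lookup_exponent_lcm image_image)

lemma aligned_divisors:
  assumes "aligned E"
  shows "E \<subseteq> divisors (lcm_monom E)"
proof
  fix j assume j: "j \<in> E"
  then have "j < length G" "snd (lm j) = snd (lcm_monom E)"
    using assms aligned_snd[OF assms j] by (auto simp: aligned_def lcm_monom_def)
  then show "j \<in> divisors (lcm_monom E)"
    using j aligned_finite[OF assms] by (simp add: divisors_iff lookup_lcm_monom)
qed

lemma lcm_monom_in_monoms:
  assumes "aligned E"
  shows "lcm_monom E \<in> monoms p"
proof -
  have "Min E < length G"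
    using aligned_Min[OF assms] assms unfolding aligned_def by blast
  then show ?thesis
    using lm_in_monoms[of "Min E"] by (simp add: lcm_monom_def monoms_def case_prod_beta)
qed

lemma Syz_restricted_lcs:
  "b \<in> Syz (*) (restricted_lcs E) \<longleftrightarrow>
    b \<in> carrier (free_module (length G)) \<and>
    (\<Sum>j\<in>E \<inter> {..<length G}. Poly_Mapping.lookup b j * lc j) = 0"
proof -
  have "combination (*) (restricted_lcs E) b =
      (\<Sum>j<length G. if j \<in> E then Poly_Mapping.lookup b j * lc j else 0)"
    unfolding combination_def by (intro sum.cong) (auto simp: restricted_lcs_def)
  also have "\<dots> = (\<Sum>j\<in>E \<inter> {..<length G}. Poly_Mapping.lookup b j * lc j)"
    by (subst Int_commute) (simp only: sum.inter_restrict[OF finite_lessThan])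
  finally show ?thesis
    by (simp add: Syz_def restricted_lcs_def)
qed

text \<open>
  Lifting \<open>s\<close> at the least common multiple, rather than at another common multiple, yields the
  smallest leading monomial; those of the other lifts are multiples of it.
\<close>

lemma ex_syzygy_for_candidate:
  assumes E: "aligned E" and s: "s \<in> Syz (*) (restricted_lcs E)"
    and nonzero: "Poly_Mapping.lookup s (Min E) \<noteq> 0"
  shows "\<exists>t\<in>Syz (*s) G - {0}. LM schreyer t = leading_candidate E \<and>
    LT schreyer t = monomial (leading_candidate E) (Poly_Mapping.lookup s (Min E))"
proof -
  have "E \<inter> {..<length G} = E"
    using E by (auto simp: aligned_def)
  then have "(\<Sum>j\<in>E. Poly_Mapping.lookup s j * lc j) = 0"
    using s by (simp add: Syz_restricted_lcs)
  then show ?thesis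
    unfolding leading_candidate_def
    by (rule ex_syzygy_with_leading_term[OF aligned_divisors[OF E] lcm_monom_in_monoms[OF E]])
      (use nonzero aligned_Min[OF E] aligned_finite[OF E] in auto)
qed

text \<open>
  The coefficients of \<open>u\<close> at the terms that share the image monomial \<open>M\<close> of the leading one form a
  relation between leading coefficients, since they contribute \<open>0\<close> to the coefficient at \<open>M\<close>.  For
  \<open>E\<close> one takes all indices from the leading one on whose leading monomials divide \<open>M\<close>; then the
  least common multiple divides \<open>M\<close> as well, and \<open>\<delta>\<close> is the quotient.
\<close>

lemma leading_term_of_syzygy:
  assumes u: "u \<in> Syz (*s) G" "u \<noteq> 0"
  obtains E \<delta> b where "aligned E" "b \<in> Syz (*) (restricted_lcs E)"
    and "LT schreyer u = monomial (shift \<delta> (leading_candidate E)) (Poly_Mapping.lookup b (Min E))"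
proof -
  have u_carrier: "u \<in> carrier (free_module (length G))" and u_zero: "combination (*s) G u = 0"
    using u(1) by (auto simp: Syz_def)
  define N where "N = LM schreyer u"
  define i where "i = snd N"
  define M where "M = image_monom N"
  have N: "N \<in> support u" "N \<in> monoms (length G)"
    using schreyer.LM_in_support[OF u_carrier u(2)] support_in_monoms[OF u_carrier]
    by (auto simp: N_def)
  have M: "M \<in> monoms p"
    using image_monom_in_monoms[OF N(2)] by (simp add: M_def)
  have below: "gt M (image_monom K) \<or> image_monom K = M \<and> i \<le> snd K" if K: "K \<in> support u" for K
  proof (cases "K = N")
    case False
    then have "schreyer N K"
      using schreyer.LM_greatest[OF u_carrier u(2) K] by (simp add: N_def)
    then show ?thesis
      using schreyer_iff[OF N(2) support_in_monoms[OF u_carrier K]] by (auto simp: M_def i_def)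
  qed (simp add: M_def i_def)
  define E where "E = {j \<in> divisors M. i \<le> j}"
  \<comment> \<open>The only monomial at the \<open>j\<close>-th basis vector whose image monomial is \<open>M\<close>, for \<open>j \<in> E\<close>.\<close>
  define cofactor where "cofactor j = (fst M - fst (lm j), j)" for j
  have in_E: "snd K \<in> E \<and> K = cofactor (snd K)" if "K \<in> support u" "image_monom K = M" for K
  proof -
    have "i \<le> snd K"
      using below[OF that(1)] that(2) gt_irrefl[OF M] by auto
    moreover have "snd K \<in> divisors M"
      using that support_in_monoms[OF u_carrier that(1)]
      by (auto simp: divisors_def image_monom_def monoms_def)
    moreover have "fst M = fst K + fst (lm (snd K))"
      using that(2) by (auto simp: image_monom_def)
    ultimately show ?thesis
      by (simp add: E_def cofactor_def prod_eq_iff)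
  qed
  have i_E: "i \<in> E" and N_cofactor: "N = cofactor i"
    using in_E[OF N(1)] by (simp_all add: M_def i_def)
  have finite_E: "finite E"
    using finite_divisors[of M] by (simp add: E_def)
  have Min_E: "Min E = i"
    using i_E finite_E by (intro Min_eqI) (auto simp: E_def)
  have E: "aligned E"
    using i_E by (auto simp: aligned_def Min_E E_def divisors_iff)
  define c where "c j = coefficient u (cofactor j)" for j
  define b where "b = (\<Sum>j\<in>E. Poly_Mapping.single j (c j))"
  have lookup_b: "Poly_Mapping.lookup b j = (if j \<in> E then c j else 0)" for j
    using finite_E by (simp add: b_def lookup_sum lookup_single when_def)
  have "image_monom (cofactor j) = M" if "j \<in> E" for j
    using that by (auto simp: E_def divisors_def cofactor_def image_monom_def)
  then have image_eq: "{K. K \<in> support u \<and> image_monom K = M} = cofactor ` {j \<in> E. c j \<noteq> 0}"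
    using in_E by (auto simp: c_def in_support image_iff) metis
  have "0 = coefficient (combination (*s) G u) M"
    by (simp add: u_zero)
  also have "\<dots> = (\<Sum>K | K \<in> support u \<and> image_monom K = M. coefficient u K * lc (snd K))"
    using below by (intro coefficient_combination(1)[OF u_carrier M]) blast
  also have "\<dots> = (\<Sum>j\<in>{j \<in> E. c j \<noteq> 0}. c j * lc j)"
    unfolding image_eq by (subst sum.reindex) (auto simp: inj_on_def cofactor_def c_def)
  also have "\<dots> = (\<Sum>j\<in>E. c j * lc j)"
    using finite_E by (intro sum.mono_neutral_left) auto
  also have "\<dots> = (\<Sum>j\<in>E \<inter> {..<length G}. Poly_Mapping.lookup b j * lc j)"
    by (intro sum.cong) (auto simp: lookup_b E_def divisors_def)
  finally have b: "b \<in> Syz (*) (restricted_lcs E)"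
    by (auto simp: Syz_restricted_lcs carrier_free_module lookup_b E_def divisors_def split: if_splits)
  have "Poly_Mapping.lookup (fst (lm j)) x \<le> Poly_Mapping.lookup (fst M) x" if "j \<in> E" for j x
    using that by (simp add: E_def divisors_iff)
  then have "\<exists>\<delta>. fst M = \<delta> + fst (lcm_monom E)"
    unfolding exponent_divides_iff lookup_lcm_monom
    using finite_E i_E by (auto intro!: Max.boundedI)
  then obtain \<delta> where \<delta>: "fst M = \<delta> + fst (lcm_monom E)" ..
  obtain \<epsilon> where "fst (lcm_monom E) = \<epsilon> + fst (lm i)"
    using aligned_divisors[OF E] i_E by (auto simp: divisors_def)
  then have "N = shift \<delta> (leading_candidate E)"
    unfolding N_cofactor by (simp add: cofactor_def leading_candidate_def shift_def Min_E \<delta> flip: add.assoc)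
  moreover have "LT schreyer u = monomial N (Poly_Mapping.lookup b (Min E))"
    using i_E by (simp add: schreyer.LT_eq[OF u(2)] flip: N_def)
      (simp add: Min_E lookup_b c_def N_cofactor)
  ultimately show thesis
    using that[OF E b] by simp
qed

text \<open>
  Lift generators of the relations over each of the finitely many sets \<open>E\<close>.  The leading coefficient
  of an arbitrary syzygy is the \<open>Min E\<close>-component of a relation over some \<open>E\<close>, hence a combination of
  the \<open>Min E\<close>-components of generators.
\<close>

lemma finite_leading_terms_of_syzygies:
  assumes "coherent_ring TYPE('a)"
  obtains T where "finite T" "T \<subseteq> Syz (*s) G - {0}"
    and "\<And>u. u \<in> Syz (*s) G \<Longrightarrow> u \<noteq> 0 \<Longrightarrow> LT schreyer u \<in> generated (LT schreyer ` T)"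
    and "\<And>t. t \<in> T \<Longrightarrow> \<exists>E. aligned E \<and> LM schreyer t = leading_candidate E"
proof -
  have "\<forall>E. \<exists>S. finite S \<and> Syz (*) (restricted_lcs E) = generated S"
    using assms by (simp add: coherent_ring_def finitely_generated_def)
  then obtain S where S: "\<And>E. finite (S E)" "\<And>E. Syz (*) (restricted_lcs E) = generated (S E)"
    by metis
  have S_subset: "S E \<subseteq> Syz (*) (restricted_lcs E)" for E
  proof
    fix s assume "s \<in> S E"
    then have "1 *s s \<in> generated (S E)" by (rule scale_in_generated)
    moreover have "1 *s s = s" by (rule poly_mapping_eqI) simp
    ultimately show "s \<in> Syz (*) (restricted_lcs E)" by (simp add: S(2))
  qed
  \<comment> \<open>Generators with a vanishing \<open>Min E\<close>-component contribute nothing to that component, and their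
     lifts would have other leading monomials.\<close>
  define P where "P = (SIGMA E:{E. aligned E}. {s \<in> S E. Poly_Mapping.lookup s (Min E) \<noteq> 0})"
  have "\<forall>e\<in>P. \<exists>t. t \<in> Syz (*s) G - {0} \<and> LM schreyer t = leading_candidate (fst e) \<and>
      LT schreyer t = monomial (leading_candidate (fst e)) (Poly_Mapping.lookup (snd e) (Min (fst e)))"
    using ex_syzygy_for_candidate S_subset by (fastforce simp: P_def)
  from bchoice[OF this] obtain t where t:
      "\<And>E s. (E, s) \<in> P \<Longrightarrow> t (E, s) \<in> Syz (*s) G - {0}"
      "\<And>E s. (E, s) \<in> P \<Longrightarrow> LM schreyer (t (E, s)) = leading_candidate E"
      "\<And>E s. (E, s) \<in> P \<Longrightarrow> LT schreyer (t (E, s)) =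
        monomial (leading_candidate E) (Poly_Mapping.lookup s (Min E))"
    by fastforce
  show thesis
  proof (rule that)
    have "finite {E. aligned E}"
      by (rule finite_subset[of _ "Pow {..<length G}"]) (auto simp: aligned_def)
    then show "finite (t ` P)"
      unfolding P_def using S(1) by (intro finite_imageI finite_SigmaI) auto
    show "t ` P \<subseteq> Syz (*s) G - {0}"
      using t(1) by force
    show "\<exists>E. aligned E \<and> LM schreyer v = leading_candidate E" if "v \<in> t ` P" for v
      using that t(2) by (auto simp: P_def)
    fix u assume "u \<in> Syz (*s) G" "u \<noteq> 0"
    then obtain E \<delta> b where E: "aligned E" and b: "b \<in> Syz (*) (restricted_lcs E)"
      and LT_u: "LT schreyer u =
        monomial (shift \<delta> (leading_candidate E)) (Poly_Mapping.lookup b (Min E))"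
      by (rule leading_term_of_syzygy)
    obtain a T where T: "finite T" "T \<subseteq> S E" and b_eq: "b = (\<Sum>s\<in>T. a s *s s)"
      using b by (auto simp: S(2) generated_def)
    have "monomial (shift \<delta> (leading_candidate E)) (a s * Poly_Mapping.lookup s (Min E))
        \<in> generated (LT schreyer ` t ` P)" if "s \<in> T" for s
    proof (cases "Poly_Mapping.lookup s (Min E) = 0")
      case True
      then show ?thesis by (simp add: submodule_zero[OF submodule_generated])
    next
      case False
      then have "(E, s) \<in> P" using E T(2) that by (auto simp: P_def)
      moreover from this have "monomial (shift \<delta> (leading_candidate E))
          (a s * Poly_Mapping.lookup s (Min E)) =
          Poly_Mapping.single \<delta> (a s) *s LT schreyer (t (E, s))"
        by (simp add: t(3) monomial_scale_monomial)
      ultimately show ?thesis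
        by (auto intro: scale_in_generated)
    qed
    then show "LT schreyer u \<in> generated (LT schreyer ` t ` P)"
      unfolding LT_u b_eq lookup_sum lookup_scale monomial_sum
      by (rule submodule_sum[OF submodule_generated])
  qed
qed

text \<open>
  The entry of index \<open>Min E\<close> already has the exponent of \<open>x\<close> that occurs in the least common multiple.
\<close>

lemma lookup_leading_candidate:
  assumes E: "aligned E"
    and descending: "\<And>i j. i < j \<Longrightarrow> j < length G \<Longrightarrow>
      Poly_Mapping.lookup (fst (lm j)) x \<le> Poly_Mapping.lookup (fst (lm i)) x"
  shows "Poly_Mapping.lookup (fst (leading_candidate E)) x = 0"
proof -
  have "Poly_Mapping.lookup (fst (lm j)) x \<le> Poly_Mapping.lookup (fst (lm (Min E))) x"
    if "j \<in> E" for j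
  proof (cases "Min E = j")
    case False
    then have "Min E < j" using Min_le[OF aligned_finite[OF E] that] by simp
    then show ?thesis using descending[of "Min E" j] E that by (auto simp: aligned_def)
  qed simp
  then have "Poly_Mapping.lookup (fst (lcm_monom E)) x \<le> Poly_Mapping.lookup (fst (lm (Min E))) x"
    unfolding lookup_lcm_monom using E aligned_finite[OF E] by (auto simp: aligned_def)
  then show ?thesis
    by (simp add: leading_candidate_def lookup_minus)
qed

end


section \<open>Exactness\<close>

lemma free_module_simps [simp]:
  "x \<oplus>\<^bsub>free_module p\<^esub> y = x + y" "\<zero>\<^bsub>free_module p\<^esub> = 0"
  "a \<odot>\<^bsub>free_module p\<^esub> x = a *s x"
  by (simp_all add: free_module_def)

lemma coset_eq: "W +>\<^bsub>free_module p\<^esub> x = (\<lambda>w. w + x) ` W"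
  by (auto simp: a_r_coset_def')

text \<open>
  Cosets are compared by differences, which reduces all computations in the quotient to
  computations with representatives.
\<close>

locale free_quotient =
  fixes p :: nat and W :: "(nat \<Rightarrow>\<^sub>0 'r::comm_ring) set"
  assumes submodule: "is_submodule W"
    and W_carrier: "W \<subseteq> carrier (free_module p)"
begin

abbreviation coset :: "(nat \<Rightarrow>\<^sub>0 'r) \<Rightarrow> (nat \<Rightarrow>\<^sub>0 'r) set"
  where "coset x \<equiv> W +>\<^bsub>free_module p\<^esub> x"

abbreviation quotient :: "('r, (nat \<Rightarrow>\<^sub>0 'r) set) module"
  where "quotient \<equiv> quotient_module (free_module p) W"

lemma in_coset_iff: "y \<in> coset x \<longleftrightarrow> y - x \<in> W"
  by (auto simp: coset_eq intro!: image_eqI[where x="y - x"])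

lemma coset_eq_iff: "coset x = coset y \<longleftrightarrow> x - y \<in> W"
proof
  assume "coset x = coset y"
  then have "x \<in> coset y"
    using submodule_zero[OF submodule] in_coset_iff[of x x] by simp
  then show "x - y \<in> W" by (simp add: in_coset_iff)
next
  assume *: "x - y \<in> W"
  have "z - x \<in> W \<longleftrightarrow> z - y \<in> W" for z
    using submodule_add[OF submodule _ *, of "z - x"] submodule_diff[OF submodule _ *, of "z - y"]
    by auto
  then show "coset x = coset y"
    by (auto simp: in_coset_iff)
qed

lemma coset_zero: "coset 0 = W"
  by (simp add: coset_eq)

lemma quotient_carrier: "carrier quotient = coset ` carrier (free_module p)"
  by (auto simp: quotient_module_def A_RCOSETS_def')

lemma quotient_zero: "\<zero>\<^bsub>quotient\<^esub> = W"
  by (simp add: quotient_module_def)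

lemma quotient_add: "coset x \<oplus>\<^bsub>quotient\<^esub> coset y = coset (x + y)"
proof -
  have "coset x \<oplus>\<^bsub>quotient\<^esub> coset y = {v + w | v w. v \<in> coset x \<and> w \<in> coset y}"
    by (auto simp: quotient_module_def set_add_def')
  also have "\<dots> = coset (x + y)"
  proof (intro equalityI subsetI)
    fix z assume "z \<in> {v + w | v w. v \<in> coset x \<and> w \<in> coset y}"
    then obtain v w where "z = v + w" "v - x \<in> W" "w - y \<in> W"
      by (auto simp: in_coset_iff)
    then show "z \<in> coset (x + y)"
      using submodule_add[OF submodule, of "v - x" "w - y"] by (simp add: in_coset_iff algebra_simps)
  next
    fix z assume "z \<in> coset (x + y)"
    then have "z - y \<in> coset x" "y \<in> coset y"
      using submodule_zero[OF submodule] by (auto simp: in_coset_iff algebra_simps)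
    moreover have "z = (z - y) + y" by simp
    ultimately show "z \<in> {v + w | v w. v \<in> coset x \<and> w \<in> coset y}" by blast
  qed
  finally show ?thesis .
qed

lemma quotient_smult: "a \<odot>\<^bsub>quotient\<^esub> coset x = coset (a *s x)"
proof -
  have "coset (a *s y) = coset (a *s x)" if "y \<in> coset x" for y
    using that submodule_scale[OF submodule, of "y - x" a]
    by (simp add: in_coset_iff coset_eq_iff scale_diff_right)
  moreover have "x \<in> coset x"
    using submodule_zero[OF submodule] by (simp add: in_coset_iff)
  ultimately have "(\<Union>y\<in>coset x. coset (a *s y)) = coset (a *s x)"
    by blast
  then show ?thesis
    by (simp add: quotient_module_def)
qed

lemma projection_linear: "coset \<in> linear_maps (free_module p) quotient"
  by (auto simp: linear_maps_def hom_def quotient_carrier quotient_add quotient_smult)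

lemma projection_kernel: "a_kernel (free_module p) quotient coset = W"
  using W_carrier coset_eq_iff[of _ 0] by (auto simp: a_kernel_def' quotient_zero coset_zero)

end

lemma combination_linear:
  assumes "set vs \<subseteq> carrier (free_module p)"
  shows "combination (*s) vs \<in> linear_maps (free_module (length vs)) (free_module p)"
  using submodule_combination[OF submodule_free_module assms]
  by (auto simp: linear_maps_def hom_def combination_add combination_scale)

lemma combination_kernel:
  "a_kernel (free_module (length vs)) (free_module p) (combination (*s) vs) = Syz (*s) vs"
  by (auto simp: a_kernel_def' Syz_def)

locale combination_quotient =
  fixes p :: nat and vs :: "(nat \<Rightarrow>\<^sub>0 'r::comm_ring) list"
  assumes vs_carrier: "set vs \<subseteq> carrier (free_module p)"

sublocale combination_quotient \<subseteq> free_quotient "length vs" "Syz (*s) vs"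
proof
  show "Syz (*s) vs \<subseteq> carrier (free_module (length vs))"
    by (auto simp: Syz_def)
qed (rule submodule_Syz)

context combination_quotient
begin

lemma induced_map_coset:
  "induced_map (combination (*s) vs) (coset x) = combination (*s) vs x"
proof -
  have "combination (*s) vs y = combination (*s) vs x" if "y \<in> coset x" for y
  proof -
    have "y - x \<in> Syz (*s) vs"
      using that by (simp only: in_coset_iff)
    then show ?thesis by (simp add: Syz_def combination_diff)
  qed
  moreover have "x \<in> coset x"
    using submodule_zero[OF submodule] by (simp add: in_coset_iff)
  ultimately have "combination (*s) vs ` coset x = {combination (*s) vs x}"
    by blast
  then show ?thesis by (simp add: induced_map_def)
qed

lemma induced_map_linear:
  "induced_map (combination (*s) vs) \<in> linear_maps quotient (free_module p)"
  using combination_linear[OF vs_carrier]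
  by (auto simp: linear_maps_def hom_def quotient_carrier quotient_add quotient_smult induced_map_coset)

lemma induced_map_kernel:
  "a_kernel quotient (free_module p) (induced_map (combination (*s) vs)) = {\<zero>\<^bsub>quotient\<^esub>}"
proof -
  let ?F = "carrier (free_module (length vs))"
  have coset_iff: "combination (*s) vs x = 0 \<longleftrightarrow> coset x = Syz (*s) vs" if "x \<in> ?F" for x
  proof -
    have "coset x = Syz (*s) vs \<longleftrightarrow> x \<in> Syz (*s) vs"
      using coset_eq_iff[of x 0] by (simp only: coset_zero diff_0_right)
    then show ?thesis using that by (simp add: Syz_def)
  qed
  have "a_kernel quotient (free_module p) (induced_map (combination (*s) vs)) =
      coset ` {x \<in> ?F. combination (*s) vs x = 0}"
    by (auto simp: a_kernel_def' quotient_carrier induced_map_coset)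
  also have "\<dots> = coset ` {x \<in> ?F. coset x = Syz (*s) vs}"
    by (rule arg_cong[where f="(`) coset"]) (use coset_iff in blast)
  also have "\<dots> = {Syz (*s) vs}"
    using coset_zero submodule_zero[OF submodule_free_module] by blast
  finally show ?thesis
    by (simp only: quotient_zero)
qed

lemma induced_map_image:
  "induced_map (combination (*s) vs) ` carrier quotient = generated (set vs)"
  by (simp add: quotient_carrier image_image induced_map_coset generated_list)

end

text \<open>
  The image of each map is generated by the list that defines the map.  For \<open>k > 0\<close> the \<open>k\<close>-th list
  generates the syzygies of the previous one, that is, the kernel of the next map to the right; for
  \<open>k = 0\<close> it generates \<open>U\<close>, the kernel of the projection.
\<close>

lemma exact_resolution_of_iterated_syzygies:
  fixes G :: "nat \<Rightarrow> ('x, 'a::{comm_ring, comm_monoid_mult}) mvec list"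
  assumes syzygies: "iterated_syzygies m gt U q G" and q: "1 \<le> q"
  shows "exact_resolution q
      (quotient_module (free_module (iterated_rank m G q)) (generated (set (G q))))
      (induced_map (combination (*s) (G (q - 1))))
      (\<lambda>k. free_module (iterated_rank m G k))
      (\<lambda>k. combination (*s) (G (k - 1)))
      (\<lambda>v. U +>\<^bsub>free_module m\<^esub> v)
      (quotient_module (free_module m) U)"
proof -
  have G_0: "set (G 0) \<subseteq> carrier (free_module m)" "generated (set (G 0)) = U"
    using syzygies unfolding iterated_syzygies_def groebner_basis_def by blast+
  have G_k: "set (G k) \<subseteq> carrier (free_module (iterated_rank m G k))"
      "generated (set (G k)) = Syz (*s) (G (k - 1))" if "k \<in> {1..q}" for k
    using syzygies that unfolding iterated_syzygies_def groebner_basis_def by blast+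
  have carrier: "set (G k) \<subseteq> carrier (free_module (iterated_rank m G k))" if "k \<le> q" for k
    using G_0(1) G_k(1)[of k] that by (cases "k = 0") auto
  have rank: "iterated_rank m G k = length (G (k - 1))" if "1 \<le> k" for k
    using that by (cases k) auto
  interpret last: combination_quotient "iterated_rank m G (q - 1)" "G (q - 1)"
    using carrier[of "q - 1"] by unfold_locales auto
  interpret first: free_quotient m U
  proof
    show "is_submodule U"
      unfolding G_0(2)[symmetric] by (rule submodule_generated)
    show "U \<subseteq> carrier (free_module m)"
      unfolding G_0(2)[symmetric] using G_0(1)
      by (intro generated_least submodule_free_module submodule_scale) auto
  qed
  have V: "generated (set (G q)) = Syz (*s) (G (q - 1))"
    using G_k(2)[of q] q by simp
  have exact: "(if k + 1 = q then induced_map (combination (*s) (G (q - 1))) ` carrier last.quotient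
        else combination (*s) (G (k + 1 - 1)) ` carrier (free_module (iterated_rank m G (k + 1)))) =
      (if k = 0 then a_kernel (free_module (iterated_rank m G 0)) first.quotient first.coset
       else a_kernel (free_module (iterated_rank m G k)) (free_module (iterated_rank m G (k - 1)))
         (combination (*s) (G (k - 1))))" (is "?image = ?kernel")
    if k: "k < q" for k
  proof -
    have "?image = generated (set (G k))"
      using last.induced_map_image by (auto simp: generated_list)
    also have "\<dots> = ?kernel"
      using first.projection_kernel G_0(2) G_k(2)[of k] k
        combination_kernel[of "G (k - 1)" "iterated_rank m G (k - 1)"] rank[of k]
      by (cases "k = 0") auto
    finally show ?thesis .
  qed
  have maps: "combination (*s) (G (k - 1)) \<in>
      linear_maps (free_module (iterated_rank m G k)) (free_module (iterated_rank m G (k - 1)))"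
    if "k \<in> {1..<q}" for k
    using combination_linear[OF carrier[of "k - 1"]] rank[of k] that by auto
  show ?thesis
    unfolding exact_resolution_def V rank[OF q]
    using last.induced_map_linear last.induced_map_kernel first.projection_linear
      maps exact first.quotient_carrier
    by (auto simp del: iterated_rank.simps(2) simp: iterated_rank.simps(1))
qed


section \<open>Elimination of the indeterminates\<close>

definition descending :: "'x monom_rel \<Rightarrow> 'x \<Rightarrow> ('x, 'a::zero) mvec list \<Rightarrow> bool"
  where "descending gt x G \<longleftrightarrow> sorted_wrt (\<lambda>g h.
    Poly_Mapping.lookup (fst (LM gt h)) x \<le> Poly_Mapping.lookup (fst (LM gt g)) x) G"

lemma ex_descending_list:
  assumes "finite T"
  obtains G where "set G = T" "descending gt x G"
proof -
  obtain L where L: "set L = T"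
    using finite_list[OF assms] by blast
  let ?d = "\<lambda>g. Poly_Mapping.lookup (fst (LM gt g)) x"
  have "sorted (map ?d (sort_key ?d L))" by simp
  then have "descending gt x (rev (sort_key ?d L))"
    by (simp add: descending_def sorted_wrt_map sorted_wrt_rev)
  then show thesis using L that[of "rev (sort_key ?d L)"] by simp
qed

text \<open>
  Being a Groebner basis depends on the set of entries only, so the list may be sorted as the elimination of
  \<open>x\<close> from the next list demands.
\<close>

lemma (in monomial_ordering) ex_leading_basis:
  fixes W :: "('x, 'a::{comm_ring, comm_monoid_mult}) mvec set"
  assumes "is_submodule W" "W \<subseteq> carrier (free_module p)" "finite T" "T \<subseteq> W - {0}"
    and "\<And>u. u \<in> W \<Longrightarrow> u \<noteq> 0 \<Longrightarrow> LT gt u \<in> generated (LT gt ` T)"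
  obtains G where "set G = T" "leading_basis p gt G W" "descending gt x G"
proof -
  obtain G where G: "set G = T" "descending gt x G"
    using ex_descending_list[OF assms(3)] by blast
  have "leading_basis p gt G W"
    by unfold_locales (use assms G(1) in auto)
  then show thesis using G that by blast
qed

text \<open>
  Generators of the module of leading terms are combinations of finitely many leading terms of
  elements of \<open>U\<close>; those elements form the basis.  The vector \<open>0\<close>, with \<open>LT(0) = 0\<close>, can be dropped.
\<close>

lemma (in monomial_ordering) ex_initial_basis:
  fixes U :: "('x, 'a::{comm_ring, comm_monoid_mult}) mvec set"
  assumes U: "U \<subseteq> carrier (free_module p)" "is_submodule U"
    and MLT: "finitely_generated (MLT gt U)"
  obtains G where "leading_basis p gt G U" "descending gt x G"
proof -
  obtain S where S: "finite S" "MLT gt U = generated S"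
    using MLT by (auto simp: finitely_generated_def)
  have "\<exists>B. finite B \<and> B \<subseteq> LT gt ` U \<and> s \<in> generated B" if "s \<in> S" for s
  proof -
    have "s \<in> generated (LT gt ` U)"
      using that S(2) generated_superset[of S] by (auto simp: MLT_def)
    then obtain c B where "finite B" "B \<subseteq> LT gt ` U" "s = (\<Sum>v\<in>B. c v *s v)"
      by (auto simp: generated_def)
    then show ?thesis
      by (intro exI[of _ B]) (auto simp: generated_def)
  qed
  then obtain B where B: "\<And>s. s \<in> S \<Longrightarrow> finite (B s) \<and> B s \<subseteq> LT gt ` U \<and> s \<in> generated (B s)"
    by metis
  then have "finite (\<Union>(B ` S))" "\<Union>(B ` S) \<subseteq> LT gt ` U"
    using S(1) by auto
  then obtain T where T: "T \<subseteq> U" "finite T" "\<Union>(B ` S) = LT gt ` T"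
    by (meson finite_subset_image)
  have "S \<subseteq> generated (LT gt ` T)"
    using B generated_mono[of "B _" "\<Union>(B ` S)"] unfolding T(3)[symmetric] by blast
  then have "generated S \<subseteq> generated (LT gt ` T)"
    by (intro generated_least submodule_generated submodule_scale) auto
  also have "\<dots> \<subseteq> generated (LT gt ` (T - {0}))"
  proof (rule generated_least[OF submodule_generated])
    fix c v assume "v \<in> LT gt ` T"
    then obtain u where u: "u \<in> T" "v = LT gt u" by auto
    show "c *s v \<in> generated (LT gt ` (T - {0}))"
    proof (cases "u = 0")
      case True
      then show ?thesis
        using submodule_zero[OF submodule_generated] by (simp add: u LT_def)
    next
      case False
      then show ?thesis using u by (intro scale_in_generated) auto
    qed
  qed
  finally have MLT_T: "MLT gt U \<subseteq> generated (LT gt ` (T - {0}))"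
    using S(2) by simp
  have LT_T: "LT gt u \<in> generated (LT gt ` (T - {0}))" if "u \<in> U" for u
    using MLT_T that generated_superset[of "LT gt ` U"] unfolding MLT_def by blast
  have "finite (T - {0})" "T - {0} \<subseteq> U - {0}"
    using T by auto
  then obtain G where "set G = T - {0}" "leading_basis p gt G U" "descending gt x G"
    by (rule ex_leading_basis[OF U(2,1) _ _ LT_T])
  then show thesis by (intro that)
qed

text \<open>
  One step of the iteration: every indeterminate along which \<open>G\<close> descends disappears, and the next
  list is sorted with respect to an indeterminate of one's choice.
\<close>

lemma (in leading_basis) ex_syzygy_basis:
  assumes "coherent_ring TYPE('a)"
  obtains G' where "leading_basis (length G) schreyer G' (Syz (*s) G)" "descending schreyer x G'"
    and "\<And>g y. g \<in> set G' \<Longrightarrow> descending gt y G \<Longrightarrow>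
      Poly_Mapping.lookup (fst (LM schreyer g)) y = 0"
proof -
  obtain T where T: "finite T" "T \<subseteq> Syz (*s) G - {0}"
      "\<And>u. u \<in> Syz (*s) G \<Longrightarrow> u \<noteq> 0 \<Longrightarrow> LT schreyer u \<in> generated (LT schreyer ` T)"
    and candidates: "\<And>t. t \<in> T \<Longrightarrow> \<exists>E. aligned E \<and> LM schreyer t = leading_candidate E"
    using finite_leading_terms_of_syzygies[OF assms] by blast
  have "Syz (*s) G \<subseteq> carrier (free_module (length G))"
    by (auto simp: Syz_def)
  then obtain G' where G': "set G' = T" "leading_basis (length G) schreyer G' (Syz (*s) G)"
      "descending schreyer x G'"
    by (rule schreyer.ex_leading_basis[OF submodule_Syz _ T])
  have "Poly_Mapping.lookup (fst (LM schreyer g)) y = 0" if g: "g \<in> set G'" "descending gt y G" for g y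
  proof -
    obtain E where E: "aligned E" "LM schreyer g = leading_candidate E"
      using candidates g(1) G'(1) by blast
    show ?thesis
      unfolding E(2)
      by (rule lookup_leading_candidate[OF E(1)])
        (use g(2) in \<open>simp add: descending_def sorted_wrt_iff_nth_less lm_def\<close>)
  qed
  then show thesis using G' that by blast
qed

text \<open>
  The state of the iteration consists of the rank, the order and the list; its invariant is that
  the list descends along the indeterminate whose turn it is, and that the previous indeterminates
  do not occur in its leading monomials.  Dependent choice glues the steps together.
\<close>

lemma ex_iterated_syzygies:
  fixes U :: "('x::finite, 'a::{comm_ring, comm_monoid_mult}) mvec set" and xs :: "nat \<Rightarrow> 'x"
  assumes coherent: "coherent_ring TYPE('a)"
    and U: "U \<subseteq> carrier (free_module m)" "is_submodule U"
    and order: "monomial_order m gt"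
    and MLT: "finitely_generated (MLT gt U)"
  obtains G where "\<And>q. iterated_syzygies m gt U q G"
    and "\<And>n k g. g \<in> set (G n) \<Longrightarrow> k < n \<Longrightarrow>
      Poly_Mapping.lookup (fst (LM (iterated_order gt G n) g)) (xs k) = 0"
proof -
  define P where "P n s \<longleftrightarrow> (case s of (p, gt', G) \<Rightarrow> \<exists>W. leading_basis p gt' G W \<and>
      descending gt' (xs n) G \<and>
      (\<forall>g\<in>set G. \<forall>k<n. Poly_Mapping.lookup (fst (LM gt' g)) (xs k) = 0) \<and>
      (n = 0 \<longrightarrow> p = m \<and> gt' = gt \<and> W = U))"
    for n and s :: "nat \<times> 'x monom_rel \<times> ('x, 'a) mvec list"
  define R where "R s s' \<longleftrightarrow> (case (s, s') of ((p, gt', G), (p', gt'', G')) \<Rightarrow>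
      p' = length G \<and> gt'' = schreyer_order gt' G \<and> groebner_basis p' gt'' G' (Syz (*s) G))"
    for s s' :: "nat \<times> 'x monom_rel \<times> ('x, 'a) mvec list"
  have "\<exists>s. P 0 s"
  proof -
    interpret monomial_ordering m gt by unfold_locales (rule order)
    obtain G where "leading_basis m gt G U" "descending gt (xs 0) G"
      using ex_initial_basis[OF U MLT] by blast
    then show ?thesis by (auto simp: P_def)
  qed
  moreover have "\<exists>s'. P (Suc n) s' \<and> R s s'" if s: "P n s" for n s
  proof -
    obtain p gt' G where s_eq: "s = (p, gt', G)" by (cases s)
    then obtain W where W: "leading_basis p gt' G W" and desc: "descending gt' (xs n) G"
      and zero: "\<And>g k. g \<in> set G \<Longrightarrow> k < n \<Longrightarrow> Poly_Mapping.lookup (fst (LM gt' g)) (xs k) = 0"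
      using s by (auto simp: P_def)
    interpret leading_basis p gt' G W by (rule W)
    obtain G' where G': "leading_basis (length G) schreyer G' (Syz (*s) G)"
        "descending schreyer (xs (Suc n)) G'"
      and zero': "\<And>g y. g \<in> set G' \<Longrightarrow> descending gt' y G \<Longrightarrow>
        Poly_Mapping.lookup (fst (LM schreyer g)) y = 0"
      using ex_syzygy_basis[OF coherent] by blast
    \<comment> \<open>For the current indeterminate this is the choice of the list; the previous ones have
       constant exponent \<open>0\<close>.\<close>
    have "descending gt' (xs k) G" if "k < Suc n" for k
    proof (cases "k = n")
      case False
      then show ?thesis
        using that zero by (simp add: descending_def sorted_wrt_iff_nth_less)
    qed (use desc in simp)
    then have "P (Suc n) (length G, schreyer, G')"
      using G' zero' by (auto simp: P_def)
    moreover have "R s (length G, schreyer, G')"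
      using leading_basis.groebner[OF G'(1)] by (simp add: R_def s_eq)
    ultimately show ?thesis by blast
  qed
  ultimately obtain f where f: "\<And>n. P n (f n)" "\<And>n. R (f n) (f (Suc n))"
    using dependent_nat_choice[of P "\<lambda>_. R"] by metis
  define G where "G n = snd (snd (f n))" for n
  have start: "fst (f 0) = m" "fst (snd (f 0)) = gt" "groebner_basis m gt (G 0) U"
    using f(1)[of 0] by (auto simp: P_def G_def case_prod_beta dest: leading_basis.groebner)
  have step: "fst (f (Suc n)) = length (G n)"
      "fst (snd (f (Suc n))) = schreyer_order (fst (snd (f n))) (G n)"
      "groebner_basis (fst (f (Suc n))) (fst (snd (f (Suc n)))) (G (Suc n)) (Syz (*s) (G n))" for n
    using f(2)[of n] by (auto simp: R_def G_def case_prod_beta)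
  have rank: "iterated_rank m G n = fst (f n)" for n
    by (cases n) (simp_all add: start step)
  have iterated: "iterated_order gt G n = fst (snd (f n))" for n
    by (induction n) (simp_all add: start step)
  show thesis
  proof (rule that)
    show "iterated_syzygies m gt U q G" for q
      unfolding iterated_syzygies_def
    proof (intro conjI ballI)
      fix k assume "k \<in> {1..q}"
      then obtain n where "k = Suc n" by (cases k) auto
      then show "groebner_basis (iterated_rank m G k) (iterated_order gt G k) (G k)
          (Syz (*s) (G (k - 1)))"
        using step(3)[of n] by (simp only: rank iterated diff_Suc_1)
    qed (rule start)
    show "Poly_Mapping.lookup (fst (LM (iterated_order gt G n) g)) (xs k) = 0"
      if "g \<in> set (G n)" "k < n" for n k g
      using f(1)[of n] that by (auto simp: P_def G_def iterated case_prod_beta)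
  qed
qed

theorem theorem7p5:
  fixes m :: nat
    and gt :: "'x::finite monom_rel"
    and U :: "('x, 'a::{comm_ring, comm_monoid_mult}) mvec set"
  assumes "strongly_discrete TYPE('a)"
    and "coherent_ring TYPE('a)"
    and "1 \<le> m"
    and "U \<subseteq> carrier (free_module m)"
    and "finitely_generated U"
    and "monomial_order m gt"
    and "finitely_generated (MLT gt U)"
  shows "\<exists>q G V.
    1 \<le> q \<and> q \<le> CARD('x) + 1 \<and>
    iterated_syzygies m gt U q G \<and>
    V = generated (set (G q)) \<and>
    (\<forall>g\<in>set (G q). fst (LM (iterated_order gt G q) g) = 0) \<and>
    exact_resolution q
      (quotient_module (free_module (iterated_rank m G q)) V)
      (induced_map (combination (*s) (G (q - 1))))
      (\<lambda>k. free_module (iterated_rank m G k))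
      (\<lambda>k. combination (*s) (G (k - 1)))
      (\<lambda>v. U +>\<^bsub>free_module m\<^esub> v)
      (quotient_module (free_module m) U)"
proof -
  obtain xs :: "nat \<Rightarrow> 'x" where xs: "bij_betw xs {0..<CARD('x)} UNIV"
    using ex_bij_betw_nat_finite[of "UNIV :: 'x set"] by auto
  have "is_submodule U"
    using assms(5) submodule_generated by (auto simp: finitely_generated_def)
  then obtain G where G: "\<And>q. iterated_syzygies m gt U q G"
    and zero: "\<And>n k g. g \<in> set (G n) \<Longrightarrow> k < n \<Longrightarrow>
      Poly_Mapping.lookup (fst (LM (iterated_order gt G n) g)) (xs k) = 0"
    using ex_iterated_syzygies[OF assms(2,4) _ assms(6,7), of xs] by blast
  let ?q = "CARD('x)"
  have q: "1 \<le> ?q" by (simp add: Suc_le_eq)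
  have "fst (LM (iterated_order gt G ?q) g) = 0" if g: "g \<in> set (G ?q)" for g
  proof (rule poly_mapping_eqI)
    fix x
    have "x \<in> xs ` {0..<?q}"
      using xs by (simp add: bij_betw_def)
    then show "Poly_Mapping.lookup (fst (LM (iterated_order gt G ?q) g)) x =
        Poly_Mapping.lookup 0 x"
      using zero[OF g] by auto
  qed
  then show ?thesis
    using G[of ?q] q exact_resolution_of_iterated_syzygies[OF G q]
    by (intro exI[of _ ?q] exI[of _ G] exI[of _ "generated (set (G ?q))"]) auto
qed

end
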